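(* Assume that there exist functions $\Psi_0,\varepsilon_0\in\Sigma_d$ such that the following resolvent inequality holds: $$\omega^2\lVert u\rVert_H^2+\lVert A_0^{1/2}u\rVert_H^2\le\sup\Big\{\frac{\lVert C_0u\rVert_Y^2}{\Psi_0(\omega)},\ \frac{\lVert(A_0-\omega^2I)u\rVert_H^2}{\varepsilon_0(\omega)}\Big\},\qquad\forall\omega\in\mathbb{R},\ \forall u\in D(A_0)\setminus\{0\}.$$ Then there exist functions $\mathtt T\in\Sigma_i$ and $\Psi\in\Sigma_d$ such that $$\Psi\big(\Lambda(u_0,u_1)\big)\Big(\lVert A_0^{1/2}u_0\rVert_H^2+\lVert u_1\rVert_H^2\Big)\le\int_0^{\mathtt T(\Lambda(u_0,u_1))}\lVert C_0u(t)\rVert_Y^2\,dt$$ for all $(u_0,u_1)\in (H_2\times H_1)\setminus\{(0,0)\}$, where $u$ is the solution of $\ddot u(t)+A_0u(t)=0$ $(t>0)$, $u(0)=u_0$, $\dot u(0)=u_1$, and $$\Lambda(u_0,u_1)=\frac{\lVert A_0u_0\rVert_H^2+\lVert A_0^{1/2}u_1\rVert_H^2}{\lVert A_0^{1/2}u_0\rVert_H^2+\lVert u_1\rVert_H^2}.$$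
   Context: Setting. $H$ and $Y$ are complex Hilbert spaces. $A_0:D(A_0)\subset H\to H$ is an unbounded self-adjoint positive operator with compact resolvent (all its eigenvalues are positive). For $\beta\ge 0$, $H_\beta=D(A_0^{\beta/2})$ with norm $\|u\|_{H_\beta}=\|A_0^{\beta/2}u\|_H$ (so $H_2=D(A_0)$, $H_1=D(A_0^{1/2})$). $C_0\in\mathcal L(D(A_0),Y)$ is a bounded linear operator. The second-order equation is understood through the group $e^{itA}$ on $X=H_1\times H$ (norm $\|(u,v)\|_X^2=\|A_0^{1/2}u\|_H^2+\|v\|_H^2$), where $A(u,v)=(-iv,\,iA_0u)$ with $D(A)=H_2\times H_1$ is self-adjoint: $(u(t),\dot u(t))^t=e^{itA}(u_0,u_1)^t$. Standing assumption (admissibility): for every $T>0$ there is $C_T>0$ with $\int_0^T\|C_0u(t)\|_Y^2dt\le C_T\big(\|A_0^{1/2}u_0\|_H^2+\|u_1\|_H^2\big)$ for all $(u_0,u_1)\in H_2\times H_1$. $\Sigma_d$ (resp. $\Sigma_i$) is the set of functions $\mathbb{R}\to(0,\infty)$ that are even, continuous, and non-increasing (resp. non-decreasing) on $[0,\infty)$. *)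

theory Defs
  imports "HOL-Analysis.Analysis"
begin

section \<open>Complex Hilbert spaces\<close>

class complex_vector = real_vector +
  fixes scaleC :: "complex \<Rightarrow> 'a \<Rightarrow> 'a" (infixr "*\<^sub>C" 75)
  assumes scaleC_add_right: "a *\<^sub>C (x + y) = a *\<^sub>C x + a *\<^sub>C y"
    and scaleC_add_left: "(a + b) *\<^sub>C x = a *\<^sub>C x + b *\<^sub>C x"
    and scaleC_scaleC: "a *\<^sub>C b *\<^sub>C x = (a * b) *\<^sub>C x"
    and scaleC_of_real: "complex_of_real r *\<^sub>C x = r *\<^sub>R x"

text \<open>
  The complex inner product is linear in its first argument. Its real part is the library's
  real inner product, so definiteness and \<open>norm x = sqrt (Re (cinner x x))\<close> are inherited
  from \<^class>\<open>real_inner\<close>.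
\<close>

class complex_hilbert = complex_vector + real_inner + complete_space +
  fixes cinner :: "'a \<Rightarrow> 'a \<Rightarrow> complex"
  assumes cinner_commute: "cinner x y = cnj (cinner y x)"
    and cinner_add_left: "cinner (x + y) z = cinner x z + cinner y z"
    and cinner_scaleC_left: "cinner (a *\<^sub>C x) y = a * cinner x y"
    and Re_cinner: "Re (cinner x y) = inner x y"

instantiation prod :: (complex_vector, complex_vector) complex_vector
begin

definition scaleC_prod :: "complex \<Rightarrow> 'a \<times> 'b \<Rightarrow> 'a \<times> 'b" where
  "scaleC_prod a x = (a *\<^sub>C fst x, a *\<^sub>C snd x)"

instance
  by standard
    (simp_all add: scaleC_prod_def prod_eq_iff scaleC_add_right scaleC_add_left scaleC_scaleC
      scaleC_of_real)

end

section \<open>Unbounded operators\<close>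

text \<open>
  An operator with domain \<open>D(A)\<close> is a partial function \<open>A\<close> with \<open>dom A = D(A)\<close>. Equality of
  partial functions includes equality of domains, and \<open>\<circ>\<^sub>m\<close> is the composition of unbounded
  operators on its natural domain.
\<close>

abbreviation op_app :: "('a \<rightharpoonup> 'b) \<Rightarrow> 'a \<Rightarrow> 'b" (infixr "\<cdot>" 80) where
  "A \<cdot> u \<equiv> the (A u)"

definition csubspace :: "'a::complex_vector set \<Rightarrow> bool" where
  "csubspace D \<longleftrightarrow>
     0 \<in> D \<and> (\<forall>u\<in>D. \<forall>v\<in>D. u + v \<in> D) \<and> (\<forall>c. \<forall>u\<in>D. c *\<^sub>C u \<in> D)"

definition clinear_on :: "'a::complex_vector set \<Rightarrow> ('a \<Rightarrow> 'b::complex_vector) \<Rightarrow> bool" where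
  "clinear_on D f \<longleftrightarrow>
     (\<forall>u\<in>D. \<forall>v\<in>D. f (u + v) = f u + f v) \<and> (\<forall>c. \<forall>u\<in>D. f (c *\<^sub>C u) = c *\<^sub>C f u)"

text \<open>
  The last conjunct is \<open>A = A\<^sup>*\<close> written for graphs: \<open>y\<close> belongs to \<open>D(A\<^sup>*)\<close> with \<open>A\<^sup>* y = z\<close>
  iff the right-hand side of the equivalence holds.
\<close>

definition self_adjoint :: "('a::complex_hilbert \<rightharpoonup> 'a) \<Rightarrow> bool" where
  "self_adjoint A \<longleftrightarrow>
     csubspace (dom A) \<and> clinear_on (dom A) (op_app A) \<and> closure (dom A) = UNIV \<and>
     (\<forall>y z. A y = Some z \<longleftrightarrow> (\<forall>u\<in>dom A. cinner (A \<cdot> u) y = cinner u z))"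

definition nonneg_op :: "('a::complex_hilbert \<rightharpoonup> 'a) \<Rightarrow> bool" where
  "nonneg_op A \<longleftrightarrow> (\<forall>u\<in>dom A. cinner (A \<cdot> u) u \<in> \<real> \<and> 0 \<le> Re (cinner (A \<cdot> u) u))"

definition eigenvalue :: "('a::complex_vector \<rightharpoonup> 'a) \<Rightarrow> complex \<Rightarrow> bool" where
  "eigenvalue A l \<longleftrightarrow> (\<exists>u\<in>dom A. u \<noteq> 0 \<and> A \<cdot> u = l *\<^sub>C u)"

definition unbounded_op :: "('a::complex_hilbert \<rightharpoonup> 'a) \<Rightarrow> bool" where
  "unbounded_op A \<longleftrightarrow> \<not> (\<exists>K. \<forall>u\<in>dom A. norm (A \<cdot> u) \<le> K * norm u)"

text \<open>
  Some \<open>z\<close> has a compact operator \<open>(A - z)\<^sup>-\<^sup>1\<close>, defined on the whole space. (By the resolvent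
  identity, the same then holds for every \<open>z\<close> in the resolvent set.)
\<close>

definition compact_resolvent :: "('a::complex_hilbert \<rightharpoonup> 'a) \<Rightarrow> bool" where
  "compact_resolvent A \<longleftrightarrow>
     (\<exists>z. bij_betw (\<lambda>u. A \<cdot> u - z *\<^sub>C u) (dom A) UNIV \<and>
          compact (closure (inv_into (dom A) (\<lambda>u. A \<cdot> u - z *\<^sub>C u) ` cball 0 1)))"

text \<open>
  \<open>S = A\<^sup>1\<^sup>/\<^sup>2\<close>. A nonnegative self-adjoint operator has exactly one square root in this sense.
\<close>

definition is_sqrt_op :: "('a::complex_hilbert \<rightharpoonup> 'a) \<Rightarrow> ('a \<rightharpoonup> 'a) \<Rightarrow> bool" where
  "is_sqrt_op S A \<longleftrightarrow> self_adjoint S \<and> nonneg_op S \<and> S \<circ>\<^sub>m S = A"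

text \<open>
  \<open>C\<close> belongs to \<open>\<L>(D(A), Y)\<close>, where \<open>D(A) = H\<^sub>2\<close> has the norm \<open>\<lambda>u. norm (A u)\<close>.
  The values of \<open>C\<close> outside \<open>D(A)\<close> are irrelevant.
\<close>

definition bounded_on_domain ::
  "('a::complex_hilbert \<rightharpoonup> 'a) \<Rightarrow> ('a \<Rightarrow> 'b::complex_hilbert) \<Rightarrow> bool" where
  "bounded_on_domain A C \<longleftrightarrow>
     clinear_on (dom A) C \<and> (\<exists>K. \<forall>u\<in>dom A. norm (C u) \<le> K * norm (A \<cdot> u))"

section \<open>The unitary group of a self-adjoint operator\<close>

text \<open>
  The space is a complex vector space \<open>X\<close> with a norm \<open>N\<close>, given as a subset of a type.
  \<open>U\<close> is the group \<open>t \<mapsto> e\<^sup>i\<^sup>t\<^sup>A\<close> of Stone's theorem, that is, the strongly continuous unitary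
  group on \<open>X\<close> whose infinitesimal generator is \<open>i A\<close>. The last conjunct identifies the graph
  of the generator, and with it the domain, with the graph of \<open>i A\<close>.
\<close>

definition unitary_group ::
  "'b::complex_vector set \<Rightarrow> ('b \<Rightarrow> real) \<Rightarrow> (real \<Rightarrow> 'b \<Rightarrow> 'b) \<Rightarrow> bool" where
  "unitary_group X N U \<longleftrightarrow>
     (\<forall>t. \<forall>x\<in>X. U t x \<in> X \<and> N (U t x) = N x) \<and>
     (\<forall>t. clinear_on X (U t)) \<and>
     (\<forall>x\<in>X. U 0 x = x) \<and>
     (\<forall>s t. \<forall>x\<in>X. U (s + t) x = U s (U t x)) \<and>
     (\<forall>x\<in>X. ((\<lambda>t. N (U t x - x)) \<longlongrightarrow> 0) (at 0))"

definition is_exp_group ::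
  "'b::complex_vector set \<Rightarrow> ('b \<Rightarrow> real) \<Rightarrow> ('b \<rightharpoonup> 'b) \<Rightarrow> (real \<Rightarrow> 'b \<Rightarrow> 'b) \<Rightarrow> bool" where
  "is_exp_group X N A U \<longleftrightarrow>
     unitary_group X N U \<and>
     (\<forall>x\<in>X. \<forall>y\<in>X.
        ((\<lambda>t. N ((1 / t) *\<^sub>R (U t x - x) - y)) \<longlongrightarrow> 0) (at 0) \<longleftrightarrow>
        map_option (scaleC \<i>) (A x) = Some y)"

section \<open>The second-order equation\<close>

text \<open>In what follows, \<open>S\<close> stands for \<open>A\<^sub>0\<^sup>1\<^sup>/\<^sup>2\<close>, so that \<open>H\<^sub>2 = dom A0\<close> and \<open>H\<^sub>1 = dom S\<close>.\<close>

definition energy :: "('a::complex_hilbert \<rightharpoonup> 'a) \<Rightarrow> 'a \<times> 'a \<Rightarrow> real" where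
  "energy S x = (norm (S \<cdot> fst x))\<^sup>2 + (norm (snd x))\<^sup>2"

definition energy_space :: "('a::complex_hilbert \<rightharpoonup> 'a) \<Rightarrow> ('a \<times> 'a) set" where
  "energy_space S = dom S \<times> UNIV"

definition wave_op ::
  "('a::complex_hilbert \<rightharpoonup> 'a) \<Rightarrow> ('a \<rightharpoonup> 'a) \<Rightarrow> ('a \<times> 'a \<rightharpoonup> 'a \<times> 'a)" where
  "wave_op A0 S = (\<lambda>(u, v).
     if u \<in> dom A0 \<and> v \<in> dom S then Some (- (\<i> *\<^sub>C v), \<i> *\<^sub>C (A0 \<cdot> u)) else None)"

definition is_wave_group ::
  "('a::complex_hilbert \<rightharpoonup> 'a) \<Rightarrow> ('a \<rightharpoonup> 'a) \<Rightarrow> (real \<Rightarrow> 'a \<times> 'a \<Rightarrow> 'a \<times> 'a) \<Rightarrow> bool" where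
  "is_wave_group A0 S U \<longleftrightarrow>
     is_exp_group (energy_space S) (\<lambda>x. sqrt (energy S x)) (wave_op A0 S) U"

definition wave_solution :: "(real \<Rightarrow> 'a \<times> 'a \<Rightarrow> 'a \<times> 'a) \<Rightarrow> 'a \<Rightarrow> 'a \<Rightarrow> real \<Rightarrow> 'a" where
  "wave_solution U u0 u1 t = fst (U t (u0, u1))"

definition admissible ::
  "('a::complex_hilbert \<rightharpoonup> 'a) \<Rightarrow> ('a \<rightharpoonup> 'a) \<Rightarrow> ('a \<Rightarrow> 'b::complex_hilbert) \<Rightarrow>
   (real \<Rightarrow> 'a \<times> 'a \<Rightarrow> 'a \<times> 'a) \<Rightarrow> bool" where
  "admissible A0 S C U \<longleftrightarrow>
     (\<forall>T>0. \<exists>K>0. \<forall>u0\<in>dom A0. \<forall>u1\<in>dom S.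
        integral {0..T} (\<lambda>t. (norm (C (wave_solution U u0 u1 t)))\<^sup>2)
          \<le> K * ((norm (S \<cdot> u0))\<^sup>2 + (norm u1)\<^sup>2))"

definition freq :: "('a::complex_hilbert \<rightharpoonup> 'a) \<Rightarrow> ('a \<rightharpoonup> 'a) \<Rightarrow> 'a \<Rightarrow> 'a \<Rightarrow> real" ("\<Lambda>") where
  "\<Lambda> A0 S u0 u1 =
     ((norm (A0 \<cdot> u0))\<^sup>2 + (norm (S \<cdot> u1))\<^sup>2) / ((norm (S \<cdot> u0))\<^sup>2 + (norm u1)\<^sup>2)"

definition Sigma_d :: "(real \<Rightarrow> real) set" ("\<Sigma>\<^sub>d") where
  "\<Sigma>\<^sub>d = {f. (\<forall>x. 0 < f x) \<and> (\<forall>x. f (- x) = f x) \<and> continuous_on UNIV f \<and> antimono_on {0..} f}"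

definition Sigma_i :: "(real \<Rightarrow> real) set" ("\<Sigma>\<^sub>i") where
  "\<Sigma>\<^sub>i = {f. (\<forall>x. 0 < f x) \<and> (\<forall>x. f (- x) = f x) \<and> continuous_on UNIV f \<and> mono_on {0..} f}"

end

theory Submission
  imports Defs
begin

text \<open>
  Data whose frequency \<open>\<Lambda>\<close> is at most \<open>R\<close> and whose energy is \<open>1\<close> are bounded in
  the domain of the wave operator, hence precompact in the energy space. On a precompact set an observability estimate, with a
  time and a constant depending on \<open>R\<close>, follows by contradiction from unique continuation, and unique continuation
  only needs that \<open>C0\<close> does not vanish at eigenvectors of \<open>A0\<close>. The resolvent inequality gives exactly
  this: for \<open>A0 u = \<omega>\<^sup>2 u\<close> the second term of the supremum vanishes. What remains is to replace the
  constants for \<open>R = 0, 1, 2, \<dots>\<close> by continuous monotone functions of \<open>\<Lambda>\<close>.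

  To make this work without a spectral theorem, the inverse square root \<open>Q = S\<^sup>-\<^sup>1\<close> is constructed and
  shown to be compact (\<open>Q_compact\<close>). The isometry \<open>(u, v) \<mapsto> (S u, v)\<close> turns the wave group into
  a group \<open>V\<close> of linear isometries of the real Hilbert space \<open>H \<times> H\<close> whose generator has a
  compact skew inverse \<open>K\<close>. With the data written in these coordinates as \<open>K y\<close>, the output
  \<open>C0 u(t)\<close> becomes \<open>Ob (V t y)\<close> for a bounded \<open>Ob\<close>, the energy is
  \<open>(norm (K y))\<^sup>2\<close>, and the numerator of \<open>\<Lambda>\<close> is \<open>(norm y)\<^sup>2\<close>.

  Suppose that the outputs of a sequence of such points \<open>y\<close>, with \<open>norm (K y) = 1\<close>, tend to zero in
  mean square on growing intervals. The limit \<open>x\<close> of a subsequence of the \<open>K y\<close> is a unit vector. Since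
  \<open>Ob (V t (K y))\<close> is a primitive of \<open>Ob (V t y)\<close>, the function \<open>t \<mapsto> Ob (V t x)\<close> is
  constant (\<open>observability_at_bounded_frequency\<close>). The vectors with this property form a closed subspace, which is
  invariant under \<open>K\<close> because a bounded affine function is constant (\<open>constant_output_K\<close>). A compact
  skew operator has an eigenvector of its square in every closed invariant subspace that it does not annihilate
  (\<open>compact_skew_eigenvector\<close>). At such an eigenvector \<open>z\<close> and at \<open>K z\<close> the map
  \<open>Ob\<close> would vanish, and this would yield an eigenvector of \<open>A0\<close> in the kernel of \<open>C0\<close>.
\<close>

section \<open>Hilbert space geometry\<close>

lemma norm_add_scaleR_squared:
  fixes a b :: "'a::real_inner"
  shows "(norm (a + c *\<^sub>R b))\<^sup>2 = (norm a)\<^sup>2 + 2 * c * inner a b + c\<^sup>2 * (norm b)\<^sup>2"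
  unfolding power2_norm_eq_inner
  by (simp add: inner_add_left inner_add_right inner_commute[of b a] power2_eq_square[of c] algebra_simps)

text \<open>
  A minimising sequence for the distance from a point \<open>f\<close> outside \<open>M\<close> is Cauchy by the parallelogram
  identity; \<open>f\<close> minus its limit is orthogonal to \<open>M\<close>.
\<close>

lemma closed_subspace_orthogonal:
  fixes M :: "'a::{real_inner, complete_space} set"
  assumes M: "subspace M" "closed M" "M \<noteq> UNIV"
  obtains y where "y \<noteq> 0" "\<And>x. x \<in> M \<Longrightarrow> inner x y = 0"
proof -
  obtain f where f: "f \<notin> M" using M(3) by auto
  define D where "D = Inf ((\<lambda>x. (norm (f - x))\<^sup>2) ` M)"
  have D_le: "D \<le> (norm (f - x))\<^sup>2" if "x \<in> M" for x
    unfolding D_def using that by (intro cINF_lower bdd_belowI2[of _ 0]) auto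
  have "\<exists>x\<in>M. (norm (f - x))\<^sup>2 < D + inverse (real (Suc n))" for n
  proof -
    have "Inf ((\<lambda>x. (norm (f - x))\<^sup>2) ` M) < D + inverse (real (Suc n))" by (simp add: D_def)
    from cInf_lessD[OF _ this] subspace_0[OF M(1)] show ?thesis by auto
  qed
  then obtain g where g: "\<And>n. g n \<in> M" "\<And>n. (norm (f - g n))\<^sup>2 < D + inverse (real (Suc n))"
    by metis
  have "Cauchy g"
  proof (rule metric_CauchyI)
    fix e :: real assume "0 < e"
    then obtain n0 where n0: "inverse (real (Suc n0)) < e\<^sup>2 / 4"
      using reals_Archimedean[of "e\<^sup>2 / 4"] by auto
    have "dist (g m) (g n) < e" if "m \<ge> n0" "n \<ge> n0" for m n
    proof -
      have "(1/2) *\<^sub>R (g m + g n) \<in> M"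
        using g M(1) by (intro subspace_scale subspace_add)
      from D_le[OF this] have "4 * D \<le> (norm (2 *\<^sub>R (f - (1/2) *\<^sub>R (g m + g n))))\<^sup>2"
        by (simp add: power_mult_distrib)
      also have "2 *\<^sub>R (f - (1/2) *\<^sub>R (g m + g n)) = (f - g m) + (f - g n)"
        by (simp add: algebra_simps scaleR_2)
      finally have 1: "4 * D \<le> (norm ((f - g m) + (f - g n)))\<^sup>2" .
      have 2: "(norm ((f - g m) + (f - g n)))\<^sup>2 + (norm (g m - g n))\<^sup>2
          = 2 * (norm (f - g m))\<^sup>2 + 2 * (norm (f - g n))\<^sup>2"
        by (simp add: power2_norm_eq_inner algebra_simps inner_commute)
      have "inverse (real (Suc m)) \<le> inverse (real (Suc n0))"
           "inverse (real (Suc n)) \<le> inverse (real (Suc n0))"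
        using that by (auto intro!: le_imp_inverse_le)
      then have "(norm (g m - g n))\<^sup>2 < e\<^sup>2"
        using 1 2 g(2)[of m] g(2)[of n] n0 by linarith
      then show ?thesis using \<open>0 < e\<close> by (simp add: dist_norm power_less_imp_less_base)
    qed
    then show "\<exists>M. \<forall>m\<ge>M. \<forall>n\<ge>M. dist (g m) (g n) < e" by blast
  qed
  then obtain p where p: "g \<longlonglongrightarrow> p" using Cauchy_convergent convergent_def by blast
  have pM: "p \<in> M" using closed_sequentially[OF M(2)] g(1) p by blast
  have "(\<lambda>n. D + inverse (real (Suc n))) \<longlonglongrightarrow> D + 0"
    by (intro tendsto_intros LIMSEQ_inverse_real_of_nat)
  then have "(norm (f - p))\<^sup>2 \<le> D"
    using g(2) p by (intro LIMSEQ_le[of "\<lambda>n. (norm (f - g n))\<^sup>2"] tendsto_intros)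
      (auto intro: less_imp_le)
  then have min: "(norm (f - p))\<^sup>2 \<le> (norm (f - p - t *\<^sub>R x))\<^sup>2" if "x \<in> M" for x t
    unfolding diff_diff_eq using that pM M(1)
    by (intro order_trans[OF _ D_le[of "p + t *\<^sub>R x"]] subspace_add subspace_scale)
  show thesis
  proof
    show "f - p \<noteq> 0" using f pM by auto
    show "inner x (f - p) = 0" if "x \<in> M" for x
    proof (rule ccontr)
      assume ne: "inner x (f - p) \<noteq> 0"
      then have x0: "inner x x > 0" by auto
      \<comment> \<open>This \<open>t\<close> minimises \<open>\<lambda>t. norm (f - p - t *\<^sub>R x)\<close>.\<close>
      define t where "t = inner x (f - p) / inner x x"
      have "(norm (f - p - t *\<^sub>R x))\<^sup>2 = (norm (f - p))\<^sup>2 - 2 * t * inner x (f - p) + t * (t * inner x x)"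
        using norm_add_scaleR_squared[of "f - p" "- t" x]
        by (simp add: inner_commute[of "f - p" x] power2_norm_eq_inner[of x] power2_eq_square[of t])
      also have "t * inner x x = inner x (f - p)" using x0 by (simp add: t_def)
      finally have "t * inner x (f - p) \<le> 0" using min[OF that, of t] by simp
      moreover have "t * inner x (f - p) > 0" using ne x0
        by (simp add: t_def power2_eq_square[symmetric])
      ultimately show False by simp
    qed
  qed
qed

text \<open>
  Let \<open>m\<close> be the supremum of \<open>norm (K z)\<close> over the unit sphere of \<open>M\<close>. Since
  \<open>K\<^sup>2\<close> is symmetric and bounded by \<open>m\<^sup>2\<close> on \<open>M\<close>, a maximising sequence
  satisfies \<open>K (K z) + m\<^sup>2 z \<rightarrow> 0\<close>. Along a subsequence \<open>K z\<close> converges by compactness,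
  hence so does \<open>K (K z)\<close>, hence so does \<open>z\<close> itself, because \<open>m\<close> is not zero. The limit is
  the eigenvector.
\<close>

lemma compact_skew_eigenvector:
  fixes K :: "'e::real_inner \<Rightarrow> 'e"
  assumes bl: "bounded_linear K"
    and skew: "\<And>x y. inner (K x) y = - inner x (K y)"
    and cpt: "\<And>f::nat \<Rightarrow> 'e. bounded (range f) \<Longrightarrow> \<exists>r a. strict_mono r \<and> (\<lambda>n. K (f (r n))) \<longlonglongrightarrow> a"
    and M: "subspace M" "closed M" "\<And>x. x \<in> M \<Longrightarrow> K x \<in> M"
    and x: "x \<in> M" "K x \<noteq> 0"
  obtains z k where "z \<in> M" "z \<noteq> 0" "0 < k" "K (K z) = - (k *\<^sub>R z)"
proof -
  interpret K: bounded_linear K by (rule bl)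
  define N where "N = (\<lambda>z. norm (K z)) ` {z \<in> M. norm z = 1}"
  define m where "m = Sup N"
  have x0: "x \<noteq> 0" using x K.zero by auto
  have x1: "x /\<^sub>R norm x \<in> {z \<in> M. norm z = 1}"
    using x0 x M(1) by (auto simp: subspace_scale)
  obtain B where B: "\<And>z. norm (K z) \<le> norm z * B" using K.bounded by auto
  have bdd: "bdd_above N"
    unfolding N_def bdd_above_def by (metis (mono_tags, lifting) B imageE mem_Collect_eq mult_1)
  have upper1: "norm (K z) \<le> m" if "z \<in> M" "norm z = 1" for z
    unfolding m_def using that by (intro cSup_upper bdd) (auto simp: N_def)
  have upper: "norm (K z) \<le> m * norm z" if "z \<in> M" for z
  proof (cases "z = 0")
    case False
    with upper1[of "z /\<^sub>R norm z"] that M(1) show ?thesis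
      by (simp add: subspace_scale K.scaleR field_simps)
  qed (simp add: K.zero)
  have "norm (K (x /\<^sub>R norm x)) \<le> m" using x1 upper1 by blast
  moreover have "0 < norm (K (x /\<^sub>R norm x))" using x x0 by (simp add: K.scaleR)
  ultimately have m: "0 < m" by linarith
  have "\<exists>z\<in>M. norm z = 1 \<and> m - inverse (real (Suc n)) < norm (K z)" for n
  proof -
    have "m - inverse (real (Suc n)) < Sup N" by (simp add: m_def)
    then have "\<exists>s\<in>N. m - inverse (real (Suc n)) < s"
      using x1 by (intro less_cSupD) (auto simp: N_def)
    then show ?thesis by (auto simp: N_def)
  qed
  then obtain f where f: "\<And>n. f n \<in> M" "\<And>n. norm (f n) = 1"
      "\<And>n. m - inverse (real (Suc n)) < norm (K (f n))" by metis
  have Kf: "(\<lambda>n. norm (K (f n))) \<longlonglongrightarrow> m"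
  proof (rule tendsto_sandwich)
    show "\<forall>\<^sub>F n in sequentially. m - inverse (real (Suc n)) \<le> norm (K (f n))"
      using f(3) by (simp add: less_imp_le)
    show "\<forall>\<^sub>F n in sequentially. norm (K (f n)) \<le> m" using f upper1 by simp
    show "(\<lambda>n. m - inverse (real (Suc n))) \<longlonglongrightarrow> m"
      using LIMSEQ_inverse_real_of_nat_add_minus[of m] by simp
  qed simp
  define d where "d n = K (K (f n)) + m\<^sup>2 *\<^sub>R f n" for n
  have d_le: "(norm (d n))\<^sup>2 \<le> m^4 - m\<^sup>2 * (norm (K (f n)))\<^sup>2" for n
  proof -
    have ip: "inner (K (K (f n))) (f n) = - (norm (K (f n)))\<^sup>2"
      by (simp add: skew power2_norm_eq_inner)
    have "(norm (d n))\<^sup>2 = (norm (K (K (f n))))\<^sup>2 - 2 * m\<^sup>2 * (norm (K (f n)))\<^sup>2 + m^4"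
      unfolding d_def norm_add_scaleR_squared by (simp add: ip f(2))
    moreover have "(norm (K (K (f n))))\<^sup>2 \<le> (m * norm (K (f n)))\<^sup>2"
      by (intro power_mono upper M f) auto
    ultimately show ?thesis by (simp add: power_mult_distrib)
  qed
  have "(\<lambda>n. m^4 - m\<^sup>2 * (norm (K (f n)))\<^sup>2) \<longlonglongrightarrow> m^4 - m\<^sup>2 * m\<^sup>2"
    by (intro tendsto_intros Kf)
  moreover have "m^4 - m\<^sup>2 * m\<^sup>2 = 0" by (simp flip: power_add)
  ultimately have lim: "(\<lambda>n. m^4 - m\<^sup>2 * (norm (K (f n)))\<^sup>2) \<longlonglongrightarrow> 0" by simp
  have "(\<lambda>n. (norm (d n))\<^sup>2) \<longlonglongrightarrow> 0"
    by (rule tendsto_sandwich[OF _ _ tendsto_const lim]) (auto intro: always_eventually d_le)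
  then have "(\<lambda>n. sqrt ((norm (d n))\<^sup>2)) \<longlonglongrightarrow> sqrt 0" by (rule tendsto_real_sqrt)
  then have d0: "d \<longlonglongrightarrow> 0" by (simp add: tendsto_norm_zero_iff)
  obtain r a where r: "strict_mono r" and a: "(\<lambda>n. K (f (r n))) \<longlonglongrightarrow> a"
    using cpt[of f] f(2) by (auto simp: bounded_iff)
  define z where "z = (1 / m\<^sup>2) *\<^sub>R (0 - K a)"
  have "(\<lambda>n. (1 / m\<^sup>2) *\<^sub>R (d (r n) - K (K (f (r n))))) \<longlonglongrightarrow> z"
    unfolding z_def using LIMSEQ_subseq_LIMSEQ[OF d0 r, unfolded o_def]
    by (rule tendsto_scaleR[OF tendsto_const tendsto_diff[OF _ K.tendsto[OF a]]])
  then have fz: "(\<lambda>n. f (r n)) \<longlonglongrightarrow> z" using m by (simp add: d_def)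
  have zM: "z \<in> M" using closed_sequentially[OF M(2) _ fz] f(1) by simp
  have "(\<lambda>n. norm (f (r n))) \<longlonglongrightarrow> norm z" using fz by (rule tendsto_norm)
  then have z1: "norm z = 1" by (simp add: f(2) LIMSEQ_const_iff)
  have "K (K z) = K a"
    by (rule LIMSEQ_unique[OF K.tendsto[OF K.tendsto[OF fz]] K.tendsto[OF a]])
  also have "\<dots> = - (m\<^sup>2 *\<^sub>R z)" using m by (simp add: z_def)
  finally show thesis using zM z1 m by (intro that[of z "m\<^sup>2"]) auto
qed

section \<open>Observability of isometry groups with compact inverse generator\<close>

text \<open>
  A strongly continuous group of linear isometries whose generator has the compact skew inverse \<open>K\<close>, seen through a
  bounded output map. A state of the domain of the generator is written \<open>x = K y\<close>, so that \<open>norm y\<close> is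
  the norm of the generator applied to \<open>x\<close>, and \<open>Ob (V t y)\<close> stands for the output at time
  \<open>t\<close> of the orbit of \<open>x\<close>: an output map that is bounded only for the graph norm of the generator
  becomes bounded in the variable \<open>y\<close>. The last assumption says that \<open>Ob\<close> cannot vanish both at an
  eigenvector \<open>z\<close> of \<open>K\<^sup>2\<close> and at \<open>K z\<close>.
\<close>

locale observed_group =
  fixes V :: "real \<Rightarrow> 'e::real_inner \<Rightarrow> 'e"
    and K :: "'e \<Rightarrow> 'e"
    and Ob :: "'e \<Rightarrow> 'y::real_inner"
  assumes V_linear: "linear (V t)"
    and V_norm: "norm (V t x) = norm x"
    and V_zero: "V 0 x = x"
    and V_add: "V (s + t) x = V s (V t x)"
    and V_cont: "((\<lambda>t. V t x) \<longlongrightarrow> x) (at 0)"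
    and V_gen: "((\<lambda>t. (1 / t) *\<^sub>R (V t x - x)) \<longlongrightarrow> y) (at 0) \<longleftrightarrow> x = K y"
    and K_linear: "bounded_linear K"
    and K_skew: "inner (K x) y = - inner x (K y)"
    and K_compact: "bounded (range (f :: nat \<Rightarrow> 'e)) \<Longrightarrow>
      \<exists>r a. strict_mono r \<and> (\<lambda>n. K (f (r n))) \<longlonglongrightarrow> a"
    and Ob_linear: "bounded_linear Ob"
    and Ob_eigenvector: "K (K z) = - (k *\<^sub>R z) \<Longrightarrow> 0 < k \<Longrightarrow> Ob z = 0 \<Longrightarrow> Ob (K z) = 0 \<Longrightarrow> z = 0"
begin

sublocale K: bounded_linear K by (rule K_linear)
sublocale Ob: bounded_linear Ob by (rule Ob_linear)

lemma V_bounded_linear: "bounded_linear (V t)"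
  by (intro bounded_linear_intro[where K = 1])
    (simp_all add: V_norm linear_add[OF V_linear] linear_scale[OF V_linear])

lemma V_diff: "V t (x - y) = V t x - V t y"
  by (rule linear_diff[OF V_linear])

lemma V_scaleR: "V t (c *\<^sub>R x) = c *\<^sub>R V t x"
  by (rule linear_scale[OF V_linear])

lemma K_inj: "K x = 0 \<Longrightarrow> x = 0"
proof -
  assume "K x = 0"
  then have "((\<lambda>t. (1 / t) *\<^sub>R (V t 0 - 0)) \<longlongrightarrow> x) (at 0)" by (subst V_gen) simp
  then have "((\<lambda>t::real. 0) \<longlongrightarrow> x) (at 0)" by (simp add: linear_0[OF V_linear])
  then show "x = 0" by (simp add: tendsto_const_iff)
qed

lemma V_K: "V s (K y) = K (V s y)"
proof -
  have "((\<lambda>t. (1 / t) *\<^sub>R (V t (K y) - K y)) \<longlongrightarrow> y) (at 0)" by (simp add: V_gen)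
  then have "((\<lambda>t. V s ((1 / t) *\<^sub>R (V t (K y) - K y))) \<longlongrightarrow> V s y) (at 0)"
    by (rule bounded_linear.tendsto[OF V_bounded_linear])
  moreover have "V s (V t (K y)) = V t (V s (K y))" for t
    by (metis V_add add.commute)
  ultimately show ?thesis by (simp add: V_diff V_scaleR V_gen)
qed

lemma V_continuous: "continuous_on A (\<lambda>t. V t x)"
proof -
  have "isCont (\<lambda>t. V t x) s" for s
  proof -
    have "((\<lambda>h. V s (V h x)) \<longlongrightarrow> V s x) (at 0)"
      by (rule bounded_linear.tendsto[OF V_bounded_linear V_cont])
    then show ?thesis by (simp add: isCont_def LIM_offset_zero_iff[where a=s] V_add[symmetric])
  qed
  then show ?thesis by (simp add: continuous_at_imp_continuous_on)
qed

lemma Ob_V_continuous: "continuous_on A (\<lambda>t. Ob (V t x))"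
  by (intro Ob.continuous_on V_continuous)

lemma output_energy_integrable: "(\<lambda>t. (norm (Ob (V t x)))\<^sup>2) integrable_on {a..b}"
  by (intro integrable_continuous_interval continuous_on_power continuous_on_norm Ob_V_continuous)

lemma V_K_derivative: "((\<lambda>t. V t (K y)) has_vector_derivative V s y) (at s)"
proof -
  have "((\<lambda>t. V s ((1 / t) *\<^sub>R (V t (K y) - K y) - y)) \<longlongrightarrow> V s (y - y)) (at 0)"
    by (intro bounded_linear.tendsto[OF V_bounded_linear] tendsto_diff tendsto_const)
      (simp add: V_gen)
  then have "((\<lambda>t. norm (V s ((1 / t) *\<^sub>R (V t (K y) - K y) - y))) \<longlongrightarrow> 0) (at 0)"
    using tendsto_norm_zero by (fastforce simp: linear_0[OF V_linear])
  moreover have "norm (V s ((1 / t) *\<^sub>R (V t (K y) - K y) - y))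
      = norm (V (s + t) (K y) - V s (K y) - t *\<^sub>R V s y) / norm t" if "t \<noteq> 0" for t
  proof -
    have "V s ((1 / t) *\<^sub>R (V t (K y) - K y) - y)
        = (1 / t) *\<^sub>R (V (s + t) (K y) - V s (K y) - t *\<^sub>R V s y)"
      using that by (simp add: V_diff V_scaleR V_add scaleR_diff_right)
    then show ?thesis by simp
  qed
  ultimately have "((\<lambda>t. norm (V (s + t) (K y) - V s (K y) - t *\<^sub>R V s y) / norm t) \<longlongrightarrow> 0) (at 0)"
    by (subst (asm) tendsto_cong) (auto simp: eventually_at_filter)
  then show ?thesis
    unfolding has_vector_derivative_def has_derivative_at
    by (auto intro: bounded_linear_scaleR_left)
qed

lemma inner_Ob_V_K_derivative:
  "((\<lambda>t. inner e (Ob (V t (K y)))) has_real_derivative inner e (Ob (V s y))) (at s within A)"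
proof -
  have "((\<lambda>t. inner e (Ob (V t (K y)))) has_vector_derivative inner e (Ob (V s y))) (at s)"
    using bounded_linear.has_vector_derivative[OF bounded_linear_compose[OF
        bounded_linear_inner_right Ob_linear] V_K_derivative] .
  then show ?thesis
    by (metis has_real_derivative_iff_has_vector_derivative has_vector_derivative_at_within)
qed

text \<open>
  Constancy of the output, rather than vanishing, is the condition that a compactness argument can produce and that
  \<open>K\<close> preserves.
\<close>

definition constant_output :: "'e set" where
  "constant_output = {x. \<forall>t. Ob (V t x) = Ob x}"

lemma closed_subspace_constant_output: "subspace constant_output" "closed constant_output"
proof -
  show "subspace constant_output"
    by (rule subspaceI) (simp_all add: constant_output_def linear_0[OF V_linear] linear_add[OF V_linear]
        V_scaleR Ob.zero Ob.add Ob.scaleR)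
  have "constant_output = (\<Inter>t. {x. Ob (V t x) = Ob x})" by (auto simp: constant_output_def)
  then show "closed constant_output"
    by (auto intro!: closed_INT closed_Collect_eq Ob.continuous_on continuous_on_id
        bounded_linear.continuous_on[OF V_bounded_linear])
qed

text \<open>
  If \<open>Ob (V t x)\<close> does not depend on \<open>t\<close>, then \<open>t \<mapsto> Ob (V t (K x))\<close> has the
  constant derivative \<open>Ob x\<close>, so it is affine. It is also bounded, because the group is isometric. A bounded affine
  function is constant.
\<close>

lemma constant_output_K:
  assumes x: "x \<in> constant_output"
  shows "Ob x = 0" "K x \<in> constant_output"
proof -
  have affine: "inner e (Ob (V t (K x))) = inner e (Ob (K x)) + t * inner e (Ob x)" for e t
  proof -
    have "((\<lambda>t. inner e (Ob (V t (K x))) - t * inner e (Ob x)) has_real_derivative 0) (at s)" for s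
      using x by (auto intro!: derivative_eq_intros inner_Ob_V_K_derivative simp: constant_output_def)
    from DERIV_isconst_all[of "\<lambda>t. inner e (Ob (V t (K x))) - t * inner e (Ob x)" t 0] this
    show ?thesis by (simp add: V_zero)
  qed
  obtain C where C: "\<And>x. norm (Ob x) \<le> norm x * C" using Ob.bounded by auto
  show "Ob x = 0"
  proof (rule ccontr)
    assume "Ob x \<noteq> 0"
    then have p: "0 < (norm (Ob x))\<^sup>2" by simp
    \<comment> \<open>At this time the affine function has moved by more than its bound allows.\<close>
    define t where "t = (2 * norm (Ob x) * (norm (K x) * C) + 1) / (norm (Ob x))\<^sup>2"
    have "\<bar>inner (Ob x) (Ob (V s (K x)))\<bar> \<le> norm (Ob x) * (norm (K x) * C)" for s
      using C[of "V s (K x)"]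
      by (intro order_trans[OF Cauchy_Schwarz_ineq2] mult_left_mono) (simp_all add: V_norm)
    from this[of t] this[of 0] affine[of "Ob x" t]
    have "t * inner (Ob x) (Ob x) \<le> 2 * norm (Ob x) * (norm (K x) * C)"
      by (simp add: V_zero)
    moreover have "t * inner (Ob x) (Ob x) = 2 * norm (Ob x) * (norm (K x) * C) + 1"
      using p by (simp add: t_def power2_norm_eq_inner)
    ultimately show False by simp
  qed
  then have "inner e (Ob (V t (K x)) - Ob (K x)) = 0" for e t
    using affine[of e t] by (simp add: inner_diff_right)
  then show "K x \<in> constant_output"
    by (auto simp: constant_output_def) (metis inner_eq_zero_iff eq_iff_diff_eq_0)
qed

text \<open>
  Unique continuation: if the closed, \<open>K\<close>-invariant subspace \<open>constant_output\<close> contained a nonzero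
  point, it would contain an eigenvector \<open>z\<close> of \<open>K\<^sup>2\<close>, and then \<open>Ob z\<close> and
  \<open>Ob (K z)\<close> would both vanish.
\<close>

lemma constant_output_trivial: "x \<in> constant_output \<Longrightarrow> x = 0"
proof (rule ccontr)
  assume x: "x \<in> constant_output" "x \<noteq> 0"
  then have "K x \<noteq> 0" using K_inj by blast
  then obtain z k where z: "z \<in> constant_output" "z \<noteq> 0" "0 < k" "K (K z) = - (k *\<^sub>R z)"
    using compact_skew_eigenvector[OF K_linear K_skew K_compact closed_subspace_constant_output
        constant_output_K(2) x(1)] by blast
  then show False using Ob_eigenvector constant_output_K by blast
qed

text \<open>
  \<open>t \<mapsto> Ob (V t (K y))\<close> is a primitive of \<open>t \<mapsto> Ob (V t y)\<close>, whose norm \<open>a\<close>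
  is controlled by its square through \<open>a \<le> 1 / n + n * a\<^sup>2\<close>. The parameter \<open>n\<close> lets a small
  energy on a bounded interval force a small increment.
\<close>

lemma Ob_V_K_increment:
  assumes "s \<le> t" "0 < n"
  shows "norm (Ob (V t (K y)) - Ob (V s (K y)))
    \<le> (t - s) / n + n * integral {s..t} (\<lambda>r. (norm (Ob (V r y)))\<^sup>2)"
proof -
  define d where "d = Ob (V t (K y)) - Ob (V s (K y))"
  define J where "J = integral {s..t} (\<lambda>r. (norm (Ob (V r y)))\<^sup>2)"
  have J: "((\<lambda>r. (norm (Ob (V r y)))\<^sup>2) has_integral J) {s..t}"
    unfolding J_def by (rule integrable_integral[OF output_energy_integrable])
  \<comment> \<open>Pairing with the increment \<open>d\<close> itself reduces the estimate to real integrals.\<close>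
  have i1: "((\<lambda>r. inner d (Ob (V r y))) has_integral
      inner d (Ob (V t (K y))) - inner d (Ob (V s (K y)))) {s..t}"
    using assms inner_Ob_V_K_derivative
    by (intro fundamental_theorem_of_calculus) (auto simp: has_real_derivative_iff_has_vector_derivative[symmetric])
  have i2: "((\<lambda>r. norm d * (1 / n + n * (norm (Ob (V r y)))\<^sup>2)) has_integral
      norm d * ((t - s) * (1 / n) + n * J)) {s..t}"
    using assms has_integral_const_real[of "1 / n" s t]
    by (intro has_integral_mult_right has_integral_add J) auto
  have "inner d (Ob (V r y)) \<le> norm d * (1 / n + n * (norm (Ob (V r y)))\<^sup>2)" for r
  proof -
    define a where "a = norm (Ob (V r y))"
    have "0 \<le> (1 - n * a)\<^sup>2" by simp
    then have "2 * (n * a) \<le> 1 + (n * a)\<^sup>2" by (simp add: power2_eq_square algebra_simps)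
    moreover have "0 \<le> n * a" using assms by (simp add: a_def)
    ultimately have "n * a \<le> n * (1 / n + n * a\<^sup>2)"
      using assms by (simp add: power2_eq_square algebra_simps)
    then have "a \<le> 1 / n + n * a\<^sup>2" using assms by simp
    then have "norm d * a \<le> norm d * (1 / n + n * a\<^sup>2)" by (rule mult_left_mono) simp
    then show ?thesis using Cauchy_Schwarz_ineq2[of d "Ob (V r y)"] by (simp add: a_def)
  qed
  then have "inner d d \<le> norm d * ((t - s) * (1 / n) + n * J)"
    using has_integral_le[OF i1 i2] by (simp add: d_def inner_diff_right)
  moreover have "0 \<le> (t - s) * (1 / n) + n * J"
    using assms has_integral_nonneg[OF J] by simp
  ultimately show ?thesis
    unfolding d_def[symmetric] J_def[symmetric]
    by (cases "d = 0") (simp_all add: dot_square_norm power2_eq_square)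
qed

text \<open>
  If the estimate fails for every \<open>a\<close>, there are points \<open>y\<close> with \<open>norm (K y) = 1\<close>, bounded
  norm, and an output energy below \<open>1 / N\<^sup>2\<close> on \<open>[-N, N]\<close>, where \<open>N\<close> tends to
  infinity. By compactness of \<open>K\<close> a subsequence of the \<open>K y\<close> converges to a unit vector
  \<open>x\<close>. The increments of \<open>t \<mapsto> Ob (V t (K y))\<close> tend to zero, so
  \<open>t \<mapsto> Ob (V t x)\<close> is constant and \<open>x\<close> must vanish. The points \<open>y\<close> themselves need
  not converge; it is for this reason that the primitive is used. The single parameter \<open>a\<close> is the observation time
  and, through \<open>1 / a\<^sup>2\<close>, also gives the constant.
\<close>

lemma observability_at_bounded_frequency:
  "\<exists>a>0. \<forall>y. (norm y)\<^sup>2 \<le> R * (norm (K y))\<^sup>2 \<longrightarrow>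
     1 / a\<^sup>2 * (norm (K y))\<^sup>2 \<le> integral {0..a} (\<lambda>t. (norm (Ob (V t y)))\<^sup>2)"
proof (rule ccontr)
  assume neg: "\<not> ?thesis"
  have "\<exists>y. norm (K y) = 1 \<and> (norm y)\<^sup>2 \<le> R \<and>
      integral {- real (Suc n)..real (Suc n)} (\<lambda>t. (norm (Ob (V t y)))\<^sup>2) \<le> 1 / (real (Suc n))\<^sup>2" for n
  proof -
    define N where "N = real (Suc n)"
    have N: "N > 0" by (simp add: N_def)
    obtain y where y: "(norm y)\<^sup>2 \<le> R * (norm (K y))\<^sup>2"
      and J: "integral {0..2 * N} (\<lambda>t. (norm (Ob (V t y)))\<^sup>2) < 1 / (2 * N)\<^sup>2 * (norm (K y))\<^sup>2"
      using neg N by (force simp: not_le dest!: spec[of _ "2 * N"])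
    have Ky: "K y \<noteq> 0" using J y by (auto simp: Ob.zero linear_0[OF V_linear])
    \<comment> \<open>The shift by \<open>N\<close> centres the interval, so that negative times are reached as well.\<close>
    define z where "z = V N (y /\<^sub>R norm (K y))"
    have shift: "Ob (V t z) = Ob (V (t + N) y) /\<^sub>R norm (K y)" for t
      by (simp add: z_def V_add V_scaleR Ob.scaleR)
    have "integral {- N..N} (\<lambda>t. (norm (Ob (V t z)))\<^sup>2)
        = integral {- N..N} (\<lambda>t. (norm (Ob (V (t + N) y)))\<^sup>2 / (norm (K y))\<^sup>2)"
      unfolding shift by (simp add: power_mult_distrib field_simps)
    also have "\<dots> = integral {- N..N} (\<lambda>t. (norm (Ob (V (t + N) y)))\<^sup>2) / (norm (K y))\<^sup>2"
      by simp
    also have "integral {- N..N} (\<lambda>t. (norm (Ob (V (t + N) y)))\<^sup>2)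
        = integral {0..2 * N} (\<lambda>t. (norm (Ob (V t y)))\<^sup>2)"
    proof (rule integral_unique)
      have "((\<lambda>t. (norm (Ob (V t y)))\<^sup>2) has_integral
          integral {0..2 * N} (\<lambda>t. (norm (Ob (V t y)))\<^sup>2)) (cbox 0 (2 * N))"
        unfolding cbox_interval by (rule integrable_integral[OF output_energy_integrable])
      from has_integral_affinity'[OF this, of 1 N]
      show "((\<lambda>t. (norm (Ob (V (t + N) y)))\<^sup>2) has_integral
          integral {0..2 * N} (\<lambda>t. (norm (Ob (V t y)))\<^sup>2)) {- N..N}"
        by simp
    qed
    also have "\<dots> / (norm (K y))\<^sup>2 \<le> 1 / (2 * N)\<^sup>2"
      using J Ky by (simp add: field_simps)
    also have "\<dots> \<le> 1 / N\<^sup>2" using N by (intro divide_left_mono power_mono) auto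
    finally have "integral {- N..N} (\<lambda>t. (norm (Ob (V t z)))\<^sup>2) \<le> 1 / N\<^sup>2" .
    moreover have "norm (K z) = 1"
      using Ky by (simp add: z_def V_K[symmetric] V_norm K.scaleR)
    moreover have "(norm z)\<^sup>2 \<le> R"
      using y Ky by (simp add: z_def V_norm power_mult_distrib field_simps)
    ultimately show ?thesis unfolding N_def by blast
  qed
  then obtain f where f: "\<And>n. norm (K (f n)) = 1" "\<And>n. (norm (f n))\<^sup>2 \<le> R"
    "\<And>n. integral {- real (Suc n)..real (Suc n)} (\<lambda>t. (norm (Ob (V t (f n))))\<^sup>2) \<le> 1 / (real (Suc n))\<^sup>2"
    by metis
  have "bounded (range f)"
    unfolding bounded_iff using f(2) by (auto intro!: exI[of _ "sqrt R"] real_le_rsqrt)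
  then obtain r x where r: "strict_mono r" and x: "(\<lambda>n. K (f (r n))) \<longlonglongrightarrow> x"
    using K_compact by blast
  have "norm x = 1" using tendsto_norm[OF x] f(1) by (simp add: LIMSEQ_const_iff)
  have eq: "Ob (V t x) = Ob (V s x)" if st: "s \<le> t" for s t
  proof -
    obtain n0 where n0: "\<bar>s\<bar> + \<bar>t\<bar> \<le> real n0" using real_arch_simple by blast
    have bound: "norm (Ob (V t (K (f (r n)))) - Ob (V s (K (f (r n)))))
        \<le> (t - s + 1) * inverse (real (Suc n))" if n: "n \<ge> n0" for n
    proof -
      define N where "N = real (Suc (r n))"
      have N: "real (Suc n) \<le> N" using seq_suble[OF r, of n] by (simp add: N_def)
      have N0: "0 < N" by (simp add: N_def)
      have "integral {s..t} (\<lambda>t. (norm (Ob (V t (f (r n)))))\<^sup>2)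
          \<le> integral {- N..N} (\<lambda>t. (norm (Ob (V t (f (r n)))))\<^sup>2)"
        using n n0 N
        by (intro integral_subset_le output_energy_integrable) auto
      also have "\<dots> \<le> 1 / N\<^sup>2" using f(3) by (simp add: N_def)
      finally have "N * integral {s..t} (\<lambda>t. (norm (Ob (V t (f (r n)))))\<^sup>2) \<le> N * (1 / N\<^sup>2)"
        using N0 by (intro mult_left_mono) auto
      then have "norm (Ob (V t (K (f (r n)))) - Ob (V s (K (f (r n))))) \<le> (t - s) / N + N * (1 / N\<^sup>2)"
        using Ob_V_K_increment[OF st N0, of "f (r n)"] by linarith
      also have "\<dots> = (t - s + 1) * inverse N"
        using N0 by (simp add: field_simps power2_eq_square)
      also have "\<dots> \<le> (t - s + 1) * inverse (real (Suc n))"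
        using st N by (intro mult_left_mono le_imp_inverse_le) auto
      finally show ?thesis .
    qed
    have "(\<lambda>n. norm (Ob (V t (K (f (r n)))) - Ob (V s (K (f (r n))))))
        \<longlonglongrightarrow> norm (Ob (V t x) - Ob (V s x))"
      by (intro tendsto_norm tendsto_diff Ob.tendsto bounded_linear.tendsto[OF V_bounded_linear] x)
    moreover have "(\<lambda>n. (t - s + 1) * inverse (real (Suc n))) \<longlonglongrightarrow> (t - s + 1) * 0"
      by (intro tendsto_mult tendsto_const LIMSEQ_inverse_real_of_nat)
    ultimately have "norm (Ob (V t x) - Ob (V s x)) \<le> (t - s + 1) * 0"
      using bound by (intro LIMSEQ_le) blast+
    then show ?thesis by simp
  qed
  have "x \<in> constant_output"
    using eq[of 0] eq[of _ 0] by (auto simp: constant_output_def V_zero) (metis linear)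
  then show False using constant_output_trivial \<open>norm x = 1\<close> by fastforce
qed

end

section \<open>Continuous monotone majorants\<close>

text \<open>
  The majorant is one plus a locally finite sum of multiples of the ramps \<open>max 0 (\<bar>x\<bar> + 2 - k)\<close>, where each
  ramp is at least \<open>1\<close> once \<open>k \<le> \<bar>x\<bar> + 1\<close>. This margin covers rounding \<open>x\<close> up
  to an integer.
\<close>

lemma Sigma_i_majorant:
  fixes a :: "nat \<Rightarrow> real"
  assumes a: "\<And>k. 0 \<le> a k"
  obtains g where "g \<in> \<Sigma>\<^sub>i" "\<And>x k. real k \<le> \<bar>x\<bar> + 1 \<Longrightarrow> a k \<le> g x"
proof
  define h where "h x k = a k * max 0 (\<bar>x\<bar> + 2 - real k)" for x k
  define g where "g x = 1 + (\<Sum>k. h x k)" for x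
  have fin: "(\<Sum>k. h x k) = (\<Sum>k<N + 2. h x k)" if "\<bar>x\<bar> \<le> real N" for x N
    by (rule suminf_finite) (use that in \<open>auto simp: h_def\<close>)
  have h0: "0 \<le> h x k" for x k using a by (simp add: h_def)
  have summ: "summable (h x)" for x
  proof -
    obtain N where "\<bar>x\<bar> \<le> real N" using real_arch_simple by blast
    then show ?thesis
      by (intro summable_finite[of "{..<N + 2}"]) (auto simp: h_def)
  qed
  have "continuous_on {- real N<..<real N} g" for N
  proof -
    have "continuous_on {- real N<..<real N} (\<lambda>x. 1 + (\<Sum>k<N + 2. h x k))"
      unfolding h_def by (intro continuous_intros)
    then show ?thesis
      by (rule continuous_on_eq) (simp add: g_def fin[of _ N] abs_le_iff
          del: sum.lessThan_Suc add_2_eq_Suc add_2_eq_Suc')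
  qed
  then have cont: "continuous_on (\<Union>N. {- real N<..<real N}) g"
    by (intro continuous_on_open_UN) auto
  have "(\<Union>N. {- real N<..<real N}) = UNIV"
  proof (rule UNIV_eq_I[symmetric])
    fix x :: real
    obtain N where "\<bar>x\<bar> < real N" using reals_Archimedean2 by blast
    then have "x \<in> {- real N<..<real N}" by auto
    then show "x \<in> (\<Union>N. {- real N<..<real N})" by blast
  qed
  with cont have "continuous_on UNIV g" by simp
  moreover have "0 < g x" for x
    unfolding g_def using suminf_nonneg[OF summ h0, of x] by simp
  moreover have "g (- x) = g x" for x by (simp add: g_def h_def)
  moreover have "mono_on {0..} g"
  proof (rule mono_onI)
    fix x y :: real assume "x \<in> {0..}" "y \<in> {0..}" "x \<le> y"
    then have "h x k \<le> h y k" for k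
      unfolding h_def by (intro mult_left_mono a) auto
    then show "g x \<le> g y" unfolding g_def by (intro add_left_mono suminf_le summ)
  qed
  ultimately show "g \<in> \<Sigma>\<^sub>i" by (auto simp: Sigma_i_def)
  show "a k \<le> g x" if "real k \<le> \<bar>x\<bar> + 1" for x k
  proof -
    have "a k * 1 \<le> h x k" unfolding h_def using that a by (intro mult_left_mono) auto
    also have "\<dots> = (\<Sum>i\<in>{k}. h x i)" by simp
    also have "\<dots> \<le> (\<Sum>i. h x i)" by (intro sum_le_suminf summ) (auto simp: h0)
    finally show ?thesis by (simp add: g_def)
  qed
qed

lemma inverse_square_Sigma_d:
  assumes "g \<in> \<Sigma>\<^sub>i" shows "(\<lambda>x. 1 / (g x)\<^sup>2) \<in> \<Sigma>\<^sub>d"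
proof -
  have pos: "0 < g x" for x using assms by (auto simp: Sigma_i_def)
  then have ne: "g x \<noteq> 0" for x by (metis less_irrefl)
  have "continuous_on UNIV g" using assms by (auto simp: Sigma_i_def)
  then have "continuous_on UNIV (\<lambda>x. 1 / (g x)\<^sup>2)"
    by (intro continuous_on_divide continuous_on_power continuous_on_const) (simp_all add: ne)
  moreover have "antimono_on {0..} (\<lambda>x. 1 / (g x)\<^sup>2)"
  proof (rule monotone_onI)
    fix x y :: real assume "x \<in> {0..}" "y \<in> {0..}" "x \<le> y"
    then have "g x \<le> g y" using assms by (auto simp: Sigma_i_def monotone_on_def)
    then show "1 / (g y)\<^sup>2 \<le> 1 / (g x)\<^sup>2"
      using pos[of x] pos[of y] by (intro divide_left_mono power_mono) auto
  qed
  ultimately show ?thesis using assms by (simp add: Sigma_d_def Sigma_i_def ne)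
qed

section \<open>Self-adjoint operators in the real inner product\<close>

lemma scaleC_real: "scaleC (complex_of_real r) = scaleR r"
  by (rule ext) (rule scaleC_of_real)

lemma scaleC_zero_left: "0 *\<^sub>C x = (0::'a::complex_vector)"
  using scaleC_of_real[of 0 x] by simp

lemma imaginary_squared: "\<i> *\<^sub>C (- (\<i> *\<^sub>C x)) = (x::'a::complex_vector)" "\<i> *\<^sub>C \<i> *\<^sub>C x = - x"
proof -
  show m: "\<i> *\<^sub>C \<i> *\<^sub>C x = - x"
    using scaleC_of_real[of "-1" x] by (simp add: scaleC_scaleC)
  have "- (\<i> *\<^sub>C x) = (- \<i>) *\<^sub>C x"
    using scaleC_of_real[of "-1" "\<i> *\<^sub>C x"] by (simp add: scaleC_scaleC)
  then show "\<i> *\<^sub>C (- (\<i> *\<^sub>C x)) = x"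
    using scaleC_of_real[of 1 x] by (simp add: scaleC_scaleC)
qed

lemma norm_scaleC: "norm (c *\<^sub>C x) = cmod c * norm (x::'a::complex_hilbert)"
proof -
  have "cinner (c *\<^sub>C x) (c *\<^sub>C x) = c * cnj c * cnj (cinner x x)"
    by (subst cinner_scaleC_left, subst cinner_commute) (simp add: cinner_scaleC_left)
  then have "(norm (c *\<^sub>C x))\<^sup>2 = Re (complex_of_real ((cmod c)\<^sup>2) * cnj (cinner x x))"
    by (simp only: power2_norm_eq_inner[of "c *\<^sub>C x"] Re_cinner[symmetric] complex_norm_square)
  also have "\<dots> = (cmod c * norm x)\<^sup>2"
    by (simp add: Re_cinner power2_norm_eq_inner[of x] power_mult_distrib del: of_real_power)
  finally show ?thesis by (simp add: power2_eq_iff_nonneg)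
qed

lemma Im_cinner: "Im (cinner x y) = - inner (\<i> *\<^sub>C x) (y::'a::complex_hilbert)"
  by (simp add: Re_cinner[symmetric] cinner_scaleC_left)

text \<open>
  Self-adjointness can be tested with the real inner product, since the imaginary part of \<open>cinner x y\<close> is the real
  part for \<open>\<i> x\<close>, up to sign, and the domain is invariant under \<open>\<i>\<close>.
\<close>

lemma self_adjoint_Some_iff:
  assumes A: "self_adjoint A"
  shows "A y = Some z \<longleftrightarrow> (\<forall>u w. A u = Some w \<longrightarrow> inner w y = inner u z)"
proof -
  have "cinner (A \<cdot> u) y = cinner u z"
    if R: "\<And>u w. A u = Some w \<Longrightarrow> inner w y = inner u z" and u: "u \<in> dom A" for u
  proof -
    have "\<i> *\<^sub>C u \<in> dom A" "A \<cdot> (\<i> *\<^sub>C u) = \<i> *\<^sub>C (A \<cdot> u)"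
      using A u unfolding self_adjoint_def csubspace_def clinear_on_def by blast+
    then have "A (\<i> *\<^sub>C u) = Some (\<i> *\<^sub>C (A \<cdot> u))" by auto
    from R[OF this] R[of u "A \<cdot> u"] u show ?thesis
      by (auto simp: complex_eq_iff Re_cinner Im_cinner)
  qed
  moreover have "inner w y = inner u z"
    if "\<forall>u\<in>dom A. cinner (A \<cdot> u) y = cinner u z" "A u = Some w" for u w
    using that by (metis Re_cinner domI option.sel)
  ultimately show ?thesis
    using A unfolding self_adjoint_def by blast
qed

lemma self_adjoint_sym:
  "self_adjoint A \<Longrightarrow> A u = Some v \<Longrightarrow> A w = Some x \<Longrightarrow> inner v w = inner u x"
  using self_adjoint_Some_iff by blast

lemma self_adjoint_memI:
  "self_adjoint A \<Longrightarrow> (\<And>u w. A u = Some w \<Longrightarrow> inner w y = inner u z) \<Longrightarrow> A y = Some z"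
  using self_adjoint_Some_iff by blast

lemma self_adjoint_zero: "self_adjoint A \<Longrightarrow> A 0 = Some 0"
  by (rule self_adjoint_memI) auto

lemma self_adjoint_add:
  assumes "self_adjoint A" "A u = Some v" "A w = Some x"
  shows "A (u + w) = Some (v + x)"
  by (rule self_adjoint_memI)
    (simp_all add: assms inner_add_right self_adjoint_sym[OF assms(1) _ assms(2)]
      self_adjoint_sym[OF assms(1) _ assms(3)])

lemma self_adjoint_scaleR:
  assumes "self_adjoint A" "A u = Some v"
  shows "A (c *\<^sub>R u) = Some (c *\<^sub>R v)"
  by (rule self_adjoint_memI) (simp_all add: assms self_adjoint_sym[OF assms(1) _ assms(2)])

lemma self_adjoint_closed:
  assumes A: "self_adjoint A" and uv: "\<And>n. A (u n) = Some (v n)"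
    and lim: "u \<longlonglongrightarrow> a" "v \<longlonglongrightarrow> b"
  shows "A a = Some b"
proof (rule self_adjoint_memI[OF A])
  fix w x assume wx: "A w = Some x"
  have "(\<lambda>n. inner x (u n)) \<longlonglongrightarrow> inner x a"
    by (rule tendsto_inner[OF tendsto_const lim(1)])
  moreover have "inner x (u n) = inner w (v n)" for n
    by (rule self_adjoint_sym[OF A wx uv])
  moreover have "(\<lambda>n. inner w (v n)) \<longlonglongrightarrow> inner w b"
    by (rule tendsto_inner[OF tendsto_const lim(2)])
  ultimately show "inner x a = inner w b" by (simp add: LIMSEQ_unique)
qed

text \<open>
  A sequence that is bounded in the graph norm lies, after scaling by \<open>1 / L\<close>, in the compact closure of the image of
  the unit ball under the resolvent.
\<close>

lemma compact_resolvent_subsequence: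
  fixes u :: "nat \<Rightarrow> 'a::complex_hilbert"
  assumes A: "self_adjoint A" "compact_resolvent A"
    and uv: "\<And>n. A (u n) = Some (v n)" and bdd: "\<And>n. norm (u n) \<le> M" "\<And>n. norm (v n) \<le> M"
  obtains r a where "strict_mono r" "(\<lambda>n. u (r n :: nat)) \<longlonglongrightarrow> a"
proof -
  obtain z where z: "bij_betw (\<lambda>u. A \<cdot> u - z *\<^sub>C u) (dom A) UNIV"
    and cpt: "compact (closure (inv_into (dom A) (\<lambda>u. A \<cdot> u - z *\<^sub>C u) ` cball 0 1))" (is "compact (closure ?S)")
    using A(2) unfolding compact_resolvent_def by (elim exE conjE)
  define L where "L = 1 + M + cmod z * M"
  have "0 \<le> M" using bdd(1)[of 0] norm_ge_zero order_trans by blast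
  then have L: "0 < L" by (simp add: L_def add_pos_nonneg)
  have "(1 / L) *\<^sub>R u n \<in> closure ?S" for n
  proof -
    let ?x = "(1 / L) *\<^sub>R u n"
    have x: "A ?x = Some ((1 / L) *\<^sub>R v n)" by (rule self_adjoint_scaleR[OF A(1) uv])
    have eq: "z *\<^sub>C ?x = (1 / L) *\<^sub>R (z *\<^sub>C u n)"
      by (simp add: scaleC_scaleC scaleC_real[symmetric] mult.commute)
    have "norm (v n - z *\<^sub>C u n) \<le> M + cmod z * M"
      using bdd by (intro norm_triangle_le_diff add_mono) (auto simp: norm_scaleC mult_left_mono)
    then have "norm ((1 / L) *\<^sub>R (v n - z *\<^sub>C u n)) \<le> 1"
      using L by (simp add: L_def)
    then have "A \<cdot> ?x - z *\<^sub>C ?x \<in> cball 0 1" by (simp add: x eq scaleR_diff_right)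
    moreover have "?x = inv_into (dom A) (\<lambda>u. A \<cdot> u - z *\<^sub>C u) (A \<cdot> ?x - z *\<^sub>C ?x)"
      using inv_into_f_f[OF bij_betw_imp_inj_on[OF z], of ?x] x by (simp add: domI)
    ultimately have "?x \<in> ?S" by (rule image_eqI[rotated])
    then show ?thesis by (rule subsetD[OF closure_subset])
  qed
  then have "\<forall>n. (1 / L) *\<^sub>R u n \<in> closure ?S" ..
  with cpt have "\<exists>l\<in>closure ?S. \<exists>r. strict_mono r \<and> ((\<lambda>n. (1 / L) *\<^sub>R u n) \<circ> r) \<longlonglongrightarrow> l"
    unfolding compact_def by (elim allE[where x = "\<lambda>n. (1 / L) *\<^sub>R u n"] impE)
  then obtain l r where r: "strict_mono r" and l: "((\<lambda>n. (1 / L) *\<^sub>R u n) \<circ> r) \<longlonglongrightarrow> l"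
    by (elim bexE exE conjE)
  have "(\<lambda>n. L *\<^sub>R ((1 / L) *\<^sub>R u (r n))) \<longlonglongrightarrow> L *\<^sub>R l"
    using l by (intro tendsto_scaleR tendsto_const) (simp add: o_def)
  then have "(\<lambda>n. u (r n)) \<longlonglongrightarrow> L *\<^sub>R l" using L by simp
  with r show thesis by (rule that)
qed

section \<open>The inverse square root\<close>

locale square_root_operator =
  fixes A0 S :: "'h::complex_hilbert \<rightharpoonup> 'h"
  assumes A0: "self_adjoint A0" "compact_resolvent A0"
    and A0_inj: "A0 u = Some 0 \<Longrightarrow> u = 0"
    and S: "is_sqrt_op S A0"
begin

lemma S_self_adjoint: "self_adjoint S"
  using S by (simp add: is_sqrt_op_def)

lemma A0_Some_iff: "A0 u = Some w \<longleftrightarrow> (\<exists>v. S u = Some v \<and> S v = Some w)"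
proof -
  have "A0 = S \<circ>\<^sub>m S" using S by (simp add: is_sqrt_op_def)
  then show ?thesis by (auto simp: map_comp_Some_iff)
qed

text \<open>
  Otherwise there are unit vectors with images tending to zero; by compactness they accumulate at a unit vector, which the closed
  operator \<open>A0\<close> maps to zero.
\<close>

lemma A0_bounded_below: "\<exists>c>0. \<forall>u f. A0 u = Some f \<longrightarrow> norm u \<le> c * norm f"
proof (rule ccontr)
  assume neg: "\<not> ?thesis"
  have "\<exists>u f. A0 u = Some f \<and> norm u = 1 \<and> norm f \<le> inverse (real (Suc n))" for n
  proof -
    obtain u f where uf: "A0 u = Some f" "norm u > real (Suc n) * norm f"
      using neg by (force simp: not_le dest!: spec[of _ "real (Suc n)"])
    then have "0 < norm u" by (smt (verit) norm_ge_zero of_nat_0_le_iff mult_nonneg_nonneg)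
    then have "norm (u /\<^sub>R norm u) = 1" by simp
    moreover have "norm (f /\<^sub>R norm u) \<le> inverse (real (Suc n))"
      using uf(2) \<open>0 < norm u\<close> by (simp add: divide_simps mult.commute del: of_nat_Suc)
    moreover have "A0 (u /\<^sub>R norm u) = Some (f /\<^sub>R norm u)"
      by (rule self_adjoint_scaleR[OF A0(1) uf(1)])
    ultimately show ?thesis by blast
  qed
  then obtain u f where uf: "\<And>n. A0 (u n) = Some (f n)" "\<And>n. norm (u n) = 1"
    "\<And>n. norm (f n) \<le> inverse (real (Suc n))" by metis
  have "norm (f n) \<le> 1" for n
    by (rule order_trans[OF uf(3)]) (simp add: inverse_le_1_iff)
  then obtain r a where r: "strict_mono r" and a: "(\<lambda>n. u (r n)) \<longlonglongrightarrow> a"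
    using compact_resolvent_subsequence[OF A0, where u = u and v = f and M = 1] uf(1,2) by auto
  have "f \<longlonglongrightarrow> 0"
    by (rule Lim_null_comparison[OF always_eventually LIMSEQ_inverse_real_of_nat]) (rule allI, rule uf(3))
  from LIMSEQ_subseq_LIMSEQ[OF this r] have "(\<lambda>n. f (r n)) \<longlonglongrightarrow> 0" by (simp add: o_def)
  with a have "A0 a = Some 0"
    by (rule self_adjoint_closed[OF A0(1), where u = "\<lambda>n. u (r n)" and v = "\<lambda>n. f (r n)", rotated])
      (rule uf(1))
  then have "a = 0" by (rule A0_inj)
  moreover have "norm a = 1" using tendsto_norm[OF a] by (simp add: uf(2) LIMSEQ_const_iff)
  ultimately show False by simp
qed

text \<open>
  The lower bound makes the range closed, and a vector orthogonal to the range belongs to the kernel.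
\<close>

lemma A0_surjective: "\<exists>u. A0 u = Some f"
proof -
  define M where "M = {f. \<exists>u. A0 u = Some f}"
  obtain c where c: "0 < c" "\<And>u f. A0 u = Some f \<Longrightarrow> norm u \<le> c * norm f"
    using A0_bounded_below by blast
  have sub: "subspace M"
    unfolding subspace_def M_def
    using self_adjoint_zero[OF A0(1)] self_adjoint_add[OF A0(1)] self_adjoint_scaleR[OF A0(1)]
    by blast
  have "closed M"
    unfolding closed_sequential_limits
  proof (intro allI impI, elim conjE)
    fix g l assume "\<forall>n. g n \<in> M" and l: "g \<longlonglongrightarrow> l"
    then obtain u where u: "\<And>n. A0 (u n) = Some (g n)" unfolding M_def by (auto, metis)
    have "Cauchy u"
    proof (rule metric_CauchyI)
      fix e :: real assume "0 < e"
      then obtain N where N: "\<And>m n. m \<ge> N \<Longrightarrow> n \<ge> N \<Longrightarrow> dist (g m) (g n) < e / c"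
        using LIMSEQ_imp_Cauchy[OF l] c(1) unfolding Cauchy_def by (meson divide_pos_pos)
      have "dist (u m) (u n) < e" if "m \<ge> N" "n \<ge> N" for m n
      proof -
        have "A0 (u m + (-1) *\<^sub>R u n) = Some (g m + (-1) *\<^sub>R g n)"
          by (intro self_adjoint_add self_adjoint_scaleR A0 u)
        from c(2)[OF this] have "dist (u m) (u n) \<le> c * dist (g m) (g n)" by (simp add: dist_norm)
        also have "\<dots> < c * (e / c)" by (rule mult_strict_left_mono[OF N[OF that] c(1)])
        finally show ?thesis using c(1) by simp
      qed
      then show "\<exists>M. \<forall>m\<ge>M. \<forall>n\<ge>M. dist (u m) (u n) < e" by blast
    qed
    then obtain a where "u \<longlonglongrightarrow> a" using Cauchy_convergent convergent_def by blast
    from self_adjoint_closed[OF A0(1) u this l] show "l \<in> M" by (auto simp: M_def)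
  qed
  have "M = UNIV"
  proof (rule ccontr)
    assume "M \<noteq> UNIV"
    then obtain y where y: "y \<noteq> 0" "\<And>x. x \<in> M \<Longrightarrow> inner x y = 0"
      using closed_subspace_orthogonal[OF sub \<open>closed M\<close>] by blast
    then have "A0 y = Some 0"
      by (intro self_adjoint_memI[OF A0(1)]) (auto simp: M_def)
    then show False using A0_inj y(1) by blast
  qed
  then show ?thesis by (auto simp: M_def)
qed

lemma S_bijective: "\<exists>!v. S v = Some f"
proof -
  have "\<exists>v. S v = Some f" using A0_surjective[of f] A0_Some_iff by blast
  moreover have "v = w" if "S v = Some f" "S w = Some f" for v w
  proof -
    have "S (v + (-1) *\<^sub>R w) = Some (f + (-1) *\<^sub>R f)"
      by (intro self_adjoint_add self_adjoint_scaleR S_self_adjoint that)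
    then have "A0 (v - w) = Some 0"
      unfolding A0_Some_iff using self_adjoint_zero[OF S_self_adjoint] by simp
    then show ?thesis using A0_inj by fastforce
  qed
  ultimately show ?thesis by blast
qed

text \<open>
  \<open>Q = S\<^sup>-\<^sup>1\<close>. In terms of this everywhere defined bounded operator, the domains of \<open>S\<close> and
  \<open>A0\<close> are the ranges of \<open>Q\<close> and \<open>Q\<^sup>2\<close>.
\<close>

definition Q :: "'h \<Rightarrow> 'h" where
  "Q f = (THE v. S v = Some f)"

lemma S_Q_iff: "S v = Some f \<longleftrightarrow> v = Q f"
  unfolding Q_def using theI'[OF S_bijective] S_bijective by blast

lemma A0_Q_iff: "A0 w = Some f \<longleftrightarrow> w = Q (Q f)"
  by (auto simp: A0_Some_iff S_Q_iff)

lemma S_Q: "S (Q f) = Some f"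
  by (simp add: S_Q_iff)

lemma A0_Q: "A0 (Q (Q f)) = Some f"
  by (simp add: A0_Q_iff)

lemma Q_cancel: "Q f = Q g \<longleftrightarrow> f = g"
  by (metis S_Q option.inject)

lemma dom_S: "dom S = range Q"
  by (auto simp: dom_def S_Q_iff)

lemma Q_sym: "inner (Q f) g = inner f (Q g)"
  using self_adjoint_sym[OF S_self_adjoint S_Q S_Q] by simp

lemma Q_add: "Q (f + g) = Q f + Q g"
  using self_adjoint_add[OF S_self_adjoint S_Q S_Q] by (simp add: S_Q_iff)

lemma Q_scaleR: "Q (c *\<^sub>R f) = c *\<^sub>R Q f"
  using self_adjoint_scaleR[OF S_self_adjoint S_Q] by (simp add: S_Q_iff)

lemma Q_minus: "Q (- f) = - Q f"
  using Q_scaleR[of "-1" f] by simp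

lemma Q_norm_le: "(norm (Q f))\<^sup>2 \<le> norm f * norm (Q (Q f))"
  using norm_cauchy_schwarz[of f "Q (Q f)"] by (simp add: power2_norm_eq_inner Q_sym)

sublocale Q: bounded_linear Q
proof -
  obtain c where c: "0 < c" "\<And>f. norm (Q (Q f)) \<le> c * norm f"
    using A0_bounded_below A0_Q by blast
  have "norm (Q f) \<le> norm f * sqrt c" for f
  proof -
    have "(norm (Q f))\<^sup>2 \<le> norm f * (c * norm f)"
      using Q_norm_le c(2) by (meson mult_left_mono norm_ge_zero order_trans)
    also have "\<dots> = (norm f * sqrt c)\<^sup>2" using c(1) by (simp add: power_mult_distrib power2_eq_square)
    finally show ?thesis by (rule power2_le_imp_le) (use c in auto)
  qed
  then show "bounded_linear Q" by (rule bounded_linear_intro[OF Q_add Q_scaleR])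
qed

text \<open>
  Compactness of \<open>Q\<^sup>2 = A0\<^sup>-\<^sup>1\<close> passes to \<open>Q\<close> because
  \<open>(norm (Q f))\<^sup>2 \<le> norm f * norm (Q (Q f))\<close>.
\<close>

lemma Q_compact:
  fixes f :: "nat \<Rightarrow> 'h"
  assumes "bounded (range f)"
  shows "\<exists>r a. strict_mono r \<and> (\<lambda>n. Q (f (r n))) \<longlonglongrightarrow> a"
proof -
  obtain M where M: "0 < M" "\<And>n. norm (f n) \<le> M"
    using assms by (auto simp: bounded_pos)
  obtain c where c: "0 < c" "\<And>f. norm (Q (Q f)) \<le> c * norm f"
    using A0_bounded_below A0_Q by blast
  have "norm (Q (Q (f n))) \<le> max M (c * M)" for n
    using c(2)[of "f n"] M(2)[of n] c(1) by (smt (verit) mult_left_mono)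
  moreover have "norm (f n) \<le> max M (c * M)" for n using M(2)[of n] by simp
  ultimately obtain r a where r: "strict_mono r" and a: "(\<lambda>n. Q (Q (f (r n)))) \<longlonglongrightarrow> a"
    using compact_resolvent_subsequence[OF A0, of "\<lambda>n. Q (Q (f n))" f] A0_Q by blast
  have "Cauchy (\<lambda>n. Q (f (r n)))"
  proof (rule metric_CauchyI)
    fix e :: real assume "0 < e"
    then have "0 < e\<^sup>2 / (2 * M)" using M by simp
    then obtain N where N: "\<And>m n. m \<ge> N \<Longrightarrow> n \<ge> N \<Longrightarrow>
        dist (Q (Q (f (r m)))) (Q (Q (f (r n)))) < e\<^sup>2 / (2 * M)"
      using LIMSEQ_imp_Cauchy[OF a] unfolding Cauchy_def by meson
    have "dist (Q (f (r m))) (Q (f (r n))) < e" if "m \<ge> N" "n \<ge> N" for m n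
    proof -
      have "(norm (Q (f (r m) - f (r n))))\<^sup>2 \<le> norm (f (r m) - f (r n)) * norm (Q (Q (f (r m) - f (r n))))"
        by (rule Q_norm_le)
      also have "\<dots> \<le> (2 * M) * norm (Q (Q (f (r m) - f (r n))))"
        using norm_triangle_ineq4[of "f (r m)" "f (r n)"] M(2)[of "r m"] M(2)[of "r n"]
        by (intro mult_right_mono) auto
      also have "\<dots> < (2 * M) * (e\<^sup>2 / (2 * M))"
        using N[OF that] M by (intro mult_strict_left_mono) (auto simp: dist_norm Q.diff)
      finally have "(norm (Q (f (r m) - f (r n))))\<^sup>2 < e\<^sup>2" using M by simp
      then show ?thesis using \<open>0 < e\<close> by (simp add: dist_norm Q.diff power_less_imp_less_base)
    qed
    then show "\<exists>M. \<forall>m\<ge>M. \<forall>n\<ge>M. dist (Q (f (r m))) (Q (f (r n))) < e" by blast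
  qed
  then show ?thesis using r Cauchy_convergent convergent_def by blast
qed

end

section \<open>The wave group in energy coordinates\<close>

locale observed_wave = square_root_operator A0 S
  for A0 S :: "'h::complex_hilbert \<rightharpoonup> 'h" +
  fixes C0 :: "'h \<Rightarrow> 'y::complex_hilbert"
    and U :: "real \<Rightarrow> 'h \<times> 'h \<Rightarrow> 'h \<times> 'h"
  assumes C0: "bounded_on_domain A0 C0"
    and wave: "is_wave_group A0 S U"
    and C0_eigenvector: "A0 u = Some (l *\<^sub>R u) \<Longrightarrow> 0 < l \<Longrightarrow> C0 u = 0 \<Longrightarrow> u = 0"
begin

text \<open>
  The map \<open>(u, v) \<mapsto> (S u, v)\<close> is an isometry of the energy space onto \<open>H \<times> H\<close> with its
  product norm; \<open>state\<close> is its inverse.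
\<close>

definition state :: "'h \<times> 'h \<Rightarrow> 'h \<times> 'h" where
  "state z = (Q (fst z), snd z)"

text \<open>
  The wave group in the coordinates \<open>(S u, v)\<close>.
\<close>

definition V :: "real \<Rightarrow> 'h \<times> 'h \<Rightarrow> 'h \<times> 'h" where
  "V t z = (S \<cdot> fst (U t (state z)), snd (U t (state z)))"

text \<open>
  In the coordinates \<open>(p, q) = (S u, v)\<close> the generator is \<open>(p, q) \<mapsto> (S q, - S p)\<close>, and
  \<open>K\<close> is its inverse.
\<close>

definition K :: "'h \<times> 'h \<Rightarrow> 'h \<times> 'h" where
  "K y = (- Q (snd y), Q (fst y))"

text \<open>
  If \<open>K y\<close> represents the data \<open>(u0, u1)\<close>, then \<open>u0 = - Q (Q (snd y))\<close>; so this is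
  \<open>C0\<close> applied to the position.
\<close>

definition Ob :: "'h \<times> 'h \<Rightarrow> 'y" where
  "Ob y = C0 (- Q (Q (snd y)))"

lemma state_mem: "state z \<in> energy_space S"
  by (simp add: state_def energy_space_def dom_S)

lemma state_linear: "state (x + y) = state x + state y" "state (c *\<^sub>R x) = c *\<^sub>R state x"
  "state (x - y) = state x - state y"
  by (simp_all add: state_def Q.add Q.scaleR Q.diff prod_eq_iff)

lemma state_cancel: "state x = state y \<longleftrightarrow> x = y"
  by (simp add: state_def Q_cancel prod_eq_iff)

lemma sqrt_energy_state: "sqrt (energy S (state z)) = norm z"
  by (simp add: energy_def state_def S_Q norm_prod_def)

lemma U_props:
  shows U_mem: "x \<in> energy_space S \<Longrightarrow> U t x \<in> energy_space S"
    and U_energy: "x \<in> energy_space S \<Longrightarrow> sqrt (energy S (U t x)) = sqrt (energy S x)"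
    and U_clinear: "clinear_on (energy_space S) (U t)"
    and U_zero: "x \<in> energy_space S \<Longrightarrow> U 0 x = x"
    and U_add: "x \<in> energy_space S \<Longrightarrow> U (s + t) x = U s (U t x)"
    and U_cont: "x \<in> energy_space S \<Longrightarrow> ((\<lambda>t. sqrt (energy S (U t x - x))) \<longlongrightarrow> 0) (at 0)"
    and U_gen: "x \<in> energy_space S \<Longrightarrow> y \<in> energy_space S \<Longrightarrow>
      ((\<lambda>t. sqrt (energy S ((1 / t) *\<^sub>R (U t x - x) - y))) \<longlongrightarrow> 0) (at 0) \<longleftrightarrow>
      map_option (scaleC \<i>) (wave_op A0 S x) = Some y"
  using wave unfolding is_wave_group_def is_exp_group_def unitary_group_def by blast+

lemma state_V: "state (V t z) = U t (state z)"
proof -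
  have "fst (U t (state z)) \<in> dom S"
    using U_mem[OF state_mem] by (metis energy_space_def mem_Times_iff)
  then obtain p where "fst (U t (state z)) = Q p" by (auto simp: dom_S)
  then show ?thesis unfolding state_def[of "V t z"] by (simp add: V_def S_Q prod_eq_iff)
qed

text \<open>
  The domain of the wave operator consists of the pairs \<open>(Q (Q w), Q v)\<close>, on which \<open>\<i> A\<close> takes the
  value \<open>(Q v, - w)\<close>.
\<close>

lemma generator_state: "map_option (scaleC \<i>) (wave_op A0 S (state x)) = Some (state y) \<longleftrightarrow> x = K y"
proof -
  have dom_A0: "Q p \<in> dom A0 \<longleftrightarrow> (\<exists>w. p = Q w)" for p
    by (auto simp: dom_def A0_Q_iff Q_cancel)
  show ?thesis
  proof
    assume L: "map_option (scaleC \<i>) (wave_op A0 S (state x)) = Some (state y)"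
    then have "Q (fst x) \<in> dom A0" "snd x \<in> dom S"
      by (auto simp: wave_op_def state_def split: if_splits)
    then obtain w v where x: "fst x = Q w" "snd x = Q v"
      unfolding dom_A0 by (auto simp: dom_S)
    have "wave_op A0 S (state x) = Some (- (\<i> *\<^sub>C Q v), \<i> *\<^sub>C w)"
      using \<open>Q (fst x) \<in> dom A0\<close> \<open>snd x \<in> dom S\<close> by (simp add: wave_op_def state_def x A0_Q)
    with L have "Q v = Q (fst y)" "- w = snd y"
      by (simp_all add: scaleC_prod_def state_def imaginary_squared)
    moreover from this(2) have "w = - snd y" by (metis minus_minus)
    ultimately show "x = K y" by (simp add: K_def prod_eq_iff x Q_minus)
  next
    assume "x = K y"
    then have x: "fst x = Q (- snd y)" "snd x = Q (fst y)" by (simp_all add: K_def Q_minus)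
    have "Q (fst x) \<in> dom A0" "snd x \<in> dom S" unfolding dom_A0 using x by (auto simp: dom_S)
    then have "wave_op A0 S (state x) = Some (- (\<i> *\<^sub>C Q (fst y)), \<i> *\<^sub>C (- snd y))"
      by (simp add: wave_op_def state_def x A0_Q)
    moreover have "\<i> *\<^sub>C \<i> *\<^sub>C (- snd y) = snd y" by (simp add: imaginary_squared)
    ultimately show "map_option (scaleC \<i>) (wave_op A0 S (state x)) = Some (state y)"
      by (simp add: scaleC_prod_def state_def imaginary_squared(1))
  qed
qed

lemma C0_linear: "u \<in> dom A0 \<Longrightarrow> v \<in> dom A0 \<Longrightarrow> C0 (u + v) = C0 u + C0 v"
  "u \<in> dom A0 \<Longrightarrow> C0 (c *\<^sub>R u) = c *\<^sub>R C0 u"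
  using C0 unfolding bounded_on_domain_def clinear_on_def scaleC_of_real[symmetric] by blast+

lemma A0_dom: "- Q (Q f) \<in> dom A0"
  using A0_Q by (auto simp: Q_minus[symmetric] intro: domI)

lemma U_scaleR: "x \<in> energy_space S \<Longrightarrow> U t (c *\<^sub>R x) = c *\<^sub>R U t x"
  using U_clinear unfolding clinear_on_def scaleC_of_real[symmetric] by blast

lemma linear_V: "linear (V t)"
proof (rule linearI)
  note lin = U_clinear[of t, unfolded clinear_on_def]
  show "V t (x + y) = V t x + V t y" for x y
    by (rule state_cancel[THEN iffD1]) (simp add: state_linear state_V lin state_mem)
  show "V t (c *\<^sub>R x) = c *\<^sub>R V t x" for c x
    by (rule state_cancel[THEN iffD1]) (simp add: state_linear state_V U_scaleR state_mem)
qed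

lemma unitary_group_V:
  shows norm_V: "norm (V t x) = norm x"
    and zero_V: "V 0 x = x"
    and add_V: "V (s + t) x = V s (V t x)"
    and cont_V: "((\<lambda>t. V t x) \<longlongrightarrow> x) (at 0)"
proof -
  show "norm (V t x) = norm x"
    unfolding sqrt_energy_state[symmetric] state_V by (rule U_energy[OF state_mem])
  show "V 0 x = x"
    by (rule state_cancel[THEN iffD1], unfold state_V) (rule U_zero[OF state_mem])
  show "V (s + t) x = V s (V t x)"
    by (rule state_cancel[THEN iffD1], unfold state_V) (rule U_add[OF state_mem])
  have "((\<lambda>t. norm (V t x - x)) \<longlongrightarrow> 0) (at 0)"
    unfolding sqrt_energy_state[symmetric] state_linear state_V by (rule U_cont[OF state_mem])
  then show "((\<lambda>t. V t x) \<longlongrightarrow> x) (at 0)"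
    by (simp add: tendsto_norm_zero_iff LIM_zero_iff)
qed

lemma generator_V: "((\<lambda>t. (1 / t) *\<^sub>R (V t x - x)) \<longlongrightarrow> y) (at 0) \<longleftrightarrow> x = K y"
proof -
  have "((\<lambda>t. (1 / t) *\<^sub>R (V t x - x)) \<longlongrightarrow> y) (at 0) \<longleftrightarrow>
      ((\<lambda>t. norm ((1 / t) *\<^sub>R (V t x - x) - y)) \<longlongrightarrow> 0) (at 0)"
    by (simp only: tendsto_norm_zero_iff LIM_zero_iff)
  also have "\<dots> \<longleftrightarrow> map_option (scaleC \<i>) (wave_op A0 S (state x)) = Some (state y)"
    unfolding sqrt_energy_state[symmetric] state_linear state_V
    by (rule U_gen[OF state_mem state_mem])
  finally show ?thesis by (simp only: generator_state)
qed

lemma bounded_linear_K: "bounded_linear K"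
  unfolding K_def[abs_def]
  by (rule bounded_linear_Pair[OF bounded_linear_minus[OF bounded_linear_compose[OF
        Q.bounded_linear_axioms bounded_linear_snd]]
        bounded_linear_compose[OF Q.bounded_linear_axioms bounded_linear_fst]])

lemma compact_K:
  fixes f :: "nat \<Rightarrow> 'h \<times> 'h"
  assumes f: "bounded (range f)"
  shows "\<exists>r a. strict_mono r \<and> (\<lambda>n. K (f (r n))) \<longlonglongrightarrow> a"
proof -
  have fst: "bounded (range (\<lambda>n. fst (f n)))" and snd: "bounded (range (\<lambda>n. snd (f n)))"
    using bounded_fst[OF f] bounded_snd[OF f] by (simp_all add: image_image)
  obtain r a where r: "strict_mono r" and a: "(\<lambda>n. Q (fst (f (r n)))) \<longlonglongrightarrow> a"
    using Q_compact[OF fst] by (elim exE conjE)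
  have "bounded (range (\<lambda>n. snd (f (r n))))"
    by (rule bounded_subset[OF snd]) blast
  then obtain r' b where r': "strict_mono r'" and b: "(\<lambda>n. Q (snd (f (r (r' n))))) \<longlonglongrightarrow> b"
    using Q_compact by blast
  have "(\<lambda>n. Q (fst (f (r (r' n))))) \<longlonglongrightarrow> a"
    using LIMSEQ_subseq_LIMSEQ[OF a r'] by (simp add: o_def)
  then have "(\<lambda>n. K (f (r (r' n)))) \<longlonglongrightarrow> (- b, a)"
    unfolding K_def by (rule tendsto_Pair[OF tendsto_minus[OF b]])
  then show ?thesis
    using strict_mono_o[OF r r'] by (intro exI[of _ "r \<circ> r'"] exI[of _ "(- b, a)"]) (simp add: o_def)
qed

lemma bounded_linear_Ob: "bounded_linear Ob"
proof -
  obtain B where B: "\<And>u. u \<in> dom A0 \<Longrightarrow> norm (C0 u) \<le> B * norm (A0 \<cdot> u)"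
    using C0 unfolding bounded_on_domain_def by blast
  have "norm (Ob x) \<le> norm x * \<bar>B\<bar>" for x
  proof -
    have "norm (Ob x) \<le> B * norm (snd x)"
      using B[OF A0_dom, of "snd x"] A0_Q[of "- snd x"] by (simp add: Ob_def Q_minus)
    also have "\<dots> \<le> \<bar>B\<bar> * norm x"
      using norm_snd_le[of "snd x" "fst x"] by (intro mult_mono) auto
    finally show ?thesis by (simp add: mult.commute)
  qed
  moreover have "Ob (x + y) = Ob x + Ob y" for x y
    using C0_linear(1)[OF A0_dom A0_dom, of "snd x" "snd y"] by (simp add: Ob_def Q_add)
  moreover have "Ob (c *\<^sub>R x) = c *\<^sub>R Ob x" for c x
    using C0_linear(2)[OF A0_dom, of c "snd x"] by (simp add: Ob_def Q_scaleR)
  ultimately show ?thesis by (intro bounded_linear_intro)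
qed

text \<open>
  \<open>K\<^sup>2\<close> acts as \<open>- Q\<^sup>2\<close> on both components, so the components of \<open>z\<close> are zero
  or eigenvectors of \<open>A0\<close>. \<open>Ob z\<close> is a multiple of \<open>C0\<close> at the second component, and
  \<open>Ob (K z)\<close> of \<open>C0\<close> at the eigenvector that \<open>Q\<close> makes of the first one.
\<close>

lemma eigenvector_observed:
  assumes z: "K (K z) = - (k *\<^sub>R z)" "0 < k" "Ob z = 0" "Ob (K z) = 0"
  shows "z = 0"
proof -
  have null: "f = 0" if f: "Q (Q f) = k *\<^sub>R f" "C0 (- Q (Q f)) = 0" for f
  proof -
    have "A0 (- Q (Q f)) = Some (- f)" using A0_Q[of "- f"] by (simp add: Q_minus)
    moreover have "- f = (1 / k) *\<^sub>R (- Q (Q f))" using f(1) z(2) by simp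
    ultimately have "- Q (Q f) = 0" using C0_eigenvector[of "- Q (Q f)" "1 / k"] f(2) z(2) by simp
    then show "f = 0" using f(1) z(2) by simp
  qed
  have QQ: "Q (Q (fst z)) = k *\<^sub>R fst z" "Q (Q (snd z)) = k *\<^sub>R snd z"
    using z(1) by (simp_all add: K_def prod_eq_iff Q_minus)
  have "snd z = 0" using null[OF QQ(2)] z(3) by (simp add: Ob_def)
  moreover have "Q (Q (Q (fst z))) = k *\<^sub>R Q (fst z)" by (simp only: QQ(1) Q_scaleR)
  then have "Q (fst z) = 0" using null z(4) by (simp add: Ob_def K_def)
  then have "fst z = 0" using Q_cancel[of "fst z" 0] by (simp add: Q.zero)
  ultimately show "z = 0" by (simp add: prod_eq_iff)
qed

lemma skew_K: "inner (K x) y = - inner x (K y)"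
  by (simp add: K_def inner_prod_def Q_sym)

sublocale observed_group V K Ob
  by (rule observed_group.intro)
    (fact linear_V norm_V zero_V add_V cont_V generator_V bounded_linear_K skew_K compact_K
      bounded_linear_Ob eigenvector_observed)+

text \<open>
  The point \<open>y\<close> is \<open>(S u1, - A0 u0)\<close>, so the quotient
  \<open>(norm y)\<^sup>2 / (norm (K y))\<^sup>2\<close> is the frequency function of the data.
\<close>

lemma data_coordinates:
  assumes "u0 \<in> dom A0" "u1 \<in> dom S"
  obtains y where "(u0, u1) = state (K y)" "norm (K y) ^ 2 = (norm (S \<cdot> u0))\<^sup>2 + (norm u1)\<^sup>2"
    "norm y ^ 2 = (norm (A0 \<cdot> u0))\<^sup>2 + (norm (S \<cdot> u1))\<^sup>2"
proof -
  obtain f g where fg: "u0 = Q (Q f)" "u1 = Q g"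
    using assms by (auto simp: A0_Q_iff S_Q_iff)
  show thesis
    by (rule that[of "(g, - f)"]) (simp_all add: fg state_def K_def Q_minus A0_Q S_Q norm_prod_def)
qed

lemma observed_wave_solution:
  assumes "(u0, u1) = state (K y)"
  shows "C0 (wave_solution U u0 u1 t) = Ob (V t y)"
  by (simp add: wave_solution_def assms state_V[symmetric] V_K)
    (simp add: state_def K_def Ob_def Q_minus)

text \<open>
  Observability up to the frequency \<open>k\<close> gives a constant \<open>a k\<close> for every natural number
  \<open>k\<close>. A majorant \<open>g\<close> of the sequence \<open>a\<close>, evaluated at the frequency of the data, is the
  observation time, and \<open>1 / g\<^sup>2\<close> is the function \<open>\<Psi>\<close>.
\<close>

lemma weak_observability:
  "\<exists>T\<in>\<Sigma>\<^sub>i. \<exists>\<Psi>\<in>\<Sigma>\<^sub>d. \<forall>(u0, u1) \<in> dom A0 \<times> dom S - {(0, 0)}.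
      \<Psi> (\<Lambda> A0 S u0 u1) * ((norm (S \<cdot> u0))\<^sup>2 + (norm u1)\<^sup>2)
        \<le> integral {0..T (\<Lambda> A0 S u0 u1)} (\<lambda>t. (norm (C0 (wave_solution U u0 u1 t)))\<^sup>2)"
proof -
  obtain a where a: "\<And>k. 0 < a k"
    and obs: "\<And>k y. (norm y)\<^sup>2 \<le> real k * (norm (K y))\<^sup>2 \<Longrightarrow>
      1 / (a k)\<^sup>2 * (norm (K y))\<^sup>2 \<le> integral {0..a k} (\<lambda>t. (norm (Ob (V t y)))\<^sup>2)"
    using observability_at_bounded_frequency[of "real k" for k] by metis
  obtain g where g: "g \<in> \<Sigma>\<^sub>i" and ag: "\<And>x k. real k \<le> \<bar>x\<bar> + 1 \<Longrightarrow> a k \<le> g x"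
    using Sigma_i_majorant[of a] a less_imp_le by metis
  have "1 / (g (\<Lambda> A0 S u0 u1))\<^sup>2 * ((norm (S \<cdot> u0))\<^sup>2 + (norm u1)\<^sup>2)
      \<le> integral {0..g (\<Lambda> A0 S u0 u1)} (\<lambda>t. (norm (C0 (wave_solution U u0 u1 t)))\<^sup>2)"
    if u: "u0 \<in> dom A0" "u1 \<in> dom S" "(u0, u1) \<noteq> (0, 0)" for u0 u1
  proof -
    define r where "r = \<Lambda> A0 S u0 u1"
    obtain y where y: "(u0, u1) = state (K y)" "(norm (K y))\<^sup>2 = (norm (S \<cdot> u0))\<^sup>2 + (norm u1)\<^sup>2"
      "(norm y)\<^sup>2 = (norm (A0 \<cdot> u0))\<^sup>2 + (norm (S \<cdot> u1))\<^sup>2"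
      using data_coordinates[OF u(1,2)] by blast
    have "K y \<noteq> 0" using y(1) u(3) by (auto simp: state_def Q.zero)
    then have r: "(norm y)\<^sup>2 = r * (norm (K y))\<^sup>2" "0 \<le> r"
      by (simp_all add: r_def freq_def y(2,3)[symmetric])
    define k where "k = nat \<lceil>r\<rceil>"
    have k: "r \<le> real k" "real k \<le> \<bar>r\<bar> + 1" using r(2) unfolding k_def by linarith+
    have "1 / (g r)\<^sup>2 * (norm (K y))\<^sup>2 \<le> 1 / (a k)\<^sup>2 * (norm (K y))\<^sup>2"
      using a[of k] ag[OF k(2)] by (intro mult_right_mono divide_left_mono power_mono) auto
    also have "\<dots> \<le> integral {0..a k} (\<lambda>t. (norm (Ob (V t y)))\<^sup>2)"
      using k(1) by (intro obs) (simp add: r(1) mult_right_mono)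
    also have "\<dots> \<le> integral {0..g r} (\<lambda>t. (norm (Ob (V t y)))\<^sup>2)"
      using ag[OF k(2)] by (intro integral_subset_le output_energy_integrable) auto
    finally show ?thesis by (simp add: r_def y(2) observed_wave_solution[OF y(1)])
  qed
  then show ?thesis
    by (intro bexI[OF _ g] bexI[OF _ inverse_square_Sigma_d[OF g]]) auto
qed

end

section \<open>Weak observability from the resolvent inequality\<close>

theorem corollary3p1:
  fixes A0 S :: "'h::complex_hilbert \<rightharpoonup> 'h"
    and C0 :: "'h \<Rightarrow> 'y::complex_hilbert"
    and U :: "real \<Rightarrow> 'h \<times> 'h \<Rightarrow> 'h \<times> 'h"
    and \<Psi>\<^sub>0 \<epsilon>\<^sub>0 :: "real \<Rightarrow> real"
  assumes "unbounded_op A0"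
    and "self_adjoint A0"
    and "nonneg_op A0"
    and "\<And>l. eigenvalue A0 l \<Longrightarrow> l \<in> \<real> \<and> 0 < Re l"
    and "compact_resolvent A0"
    and "is_sqrt_op S A0"
    and "bounded_on_domain A0 C0"
    and "is_wave_group A0 S U"
    and "admissible A0 S C0 U"
    and "\<Psi>\<^sub>0 \<in> \<Sigma>\<^sub>d" and "\<epsilon>\<^sub>0 \<in> \<Sigma>\<^sub>d"
    and "\<And>\<omega> u. u \<in> dom A0 - {0} \<Longrightarrow>
      \<omega>\<^sup>2 * (norm u)\<^sup>2 + (norm (S \<cdot> u))\<^sup>2
        \<le> max ((norm (C0 u))\<^sup>2 / \<Psi>\<^sub>0 \<omega>) ((norm (A0 \<cdot> u - \<omega>\<^sup>2 *\<^sub>R u))\<^sup>2 / \<epsilon>\<^sub>0 \<omega>)"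
  shows "\<exists>T\<in>\<Sigma>\<^sub>i. \<exists>\<Psi>\<in>\<Sigma>\<^sub>d. \<forall>(u0, u1) \<in> dom A0 \<times> dom S - {(0, 0)}.
      \<Psi> (\<Lambda> A0 S u0 u1) * ((norm (S \<cdot> u0))\<^sup>2 + (norm u1)\<^sup>2)
        \<le> integral {0..T (\<Lambda> A0 S u0 u1)} (\<lambda>t. (norm (C0 (wave_solution U u0 u1 t)))\<^sup>2)"
proof -
  have "observed_wave A0 S C0 U"
  proof
    show "u = 0" if "A0 u = Some 0" for u
    proof (rule ccontr)
      assume "u \<noteq> 0"
      then have "eigenvalue A0 0"
        unfolding eigenvalue_def using that
        by (intro bexI[of _ u]) (auto simp: scaleC_zero_left)
      then show False using assms(4) by fastforce
    qed
    \<comment> \<open>At \<open>\<omega> = sqrt l\<close> the residual of an eigenvector vanishes, so the output must dominate.\<close>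
    show "u = 0" if u: "A0 u = Some (l *\<^sub>R u)" "0 < l" "C0 u = 0" for u l
    proof (rule ccontr)
      assume "u \<noteq> 0"
      then have "(sqrt l)\<^sup>2 * (norm u)\<^sup>2 + (norm (S \<cdot> u))\<^sup>2
          \<le> max ((norm (C0 u))\<^sup>2 / \<Psi>\<^sub>0 (sqrt l)) ((norm (A0 \<cdot> u - (sqrt l)\<^sup>2 *\<^sub>R u))\<^sup>2 / \<epsilon>\<^sub>0 (sqrt l))"
        using u(1) by (intro assms(12)) auto
      also have "\<dots> = 0" using u by simp
      finally have "l * (norm u)\<^sup>2 \<le> 0" using u(2) by (smt (verit) real_sqrt_pow2 zero_le_power2)
      then show False using u(2) \<open>u \<noteq> 0\<close> by (simp add: mult_le_0_iff)
    qed
  qed (fact assms)+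
  then show ?thesis by (rule observed_wave.weak_observability)
qed

end
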